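(* Let $\nu\in(0,1]$, $\lambda_\alpha,\lambda_\beta>0$. Let $N^\nu(t)$, $t>0$, be a fractional Poisson process with parameter $\lambda_\beta$, let $\tau_k^\nu=\inf\{t:N^\nu(t)=k\}$, $k\ge1$, and let $N_\alpha$ be a homogeneous Poisson process with rate $\lambda_\alpha$ independent of $N^\nu$. Then the composed process $\tilde N^\nu(k)=N_\alpha(\tau_k^\nu)$, $k\ge1$, has the distribution $$\Pr\{\tilde N^\nu(k)=r\}=\frac1{r!}\sum_{j=0}^\infty\binom{-k}{j}\left(\frac{\lambda_\beta}{\lambda_\alpha^\nu}\right)^{k+j}\frac{\Gamma(\nu(k+j)+r)}{\Gamma(\nu(k+j))},\qquad r\ge0,$$ and possesses the probability generating function $$\mathbb{E}u^{\tilde N^\nu(k)}=\left[1+(1-u)^\nu\frac{\lambda_\alpha^\nu}{\lambda_\beta}\right]^{-k},\qquad |u|\le1.$$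
   Context: The fractional Poisson process $N^\nu$ with parameter $\lambda_\beta$ is the renewal counting process whose i.i.d. inter-arrival times $W$ are Mittag--Leffler distributed: $\Pr\{W>t\}=E_{\nu,1}(-\lambda_\beta t^\nu)$, $t\ge 0$, where $E_{\nu,1}(x)=\sum_{r\ge0}\frac{x^r}{\Gamma(\nu r+1)}$. Its state probabilities are $\Pr\{N^\nu(t)=m\}=\sum_{j=m}^\infty(-1)^{j-m}\binom jm\frac{(\lambda_\beta t^\nu)^j}{\Gamma(\nu j+1)}$. Thus $\tau_k^\nu$ is the sum of the first $k$ inter-arrival times. Here $\binom{-k}{j}=(-1)^j\binom{k+j-1}{j}$, and $(1-u)^\nu$ is the principal power.
   Formalization: The series for Pr{Ñ(k)=r} diverges when λ_β ≥ λ_α^ν; it is asserted as an ordinary sum only for λ_β < λ_α^ν, and for all λ_α, λ_β as the analytic continuation in z=λ_β/λ_α^ν. Inter-arrival times are taken positive at every outcome. *)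

theory Defs
  imports "HOL-Probability.Probability"
begin

definition mittag_leffler :: "real \<Rightarrow> real \<Rightarrow> real \<Rightarrow> real" where
  "mittag_leffler a b x = (\<Sum>r. x ^ r / Gamma (a * real r + b))"

text \<open>
  The renewal counting process of \<open>W\<close>: the inter-arrival times are \<open>W 0, W 1, \<dots>\<close>, so the
  \<open>n\<close>-th epoch is \<open>\<Sum>i<n. W i\<close>. At an outcome where infinitely many epochs lie below \<open>t\<close>
  the value is \<open>card\<close> of an infinite set, namely 0; for the inter-arrival times used here such
  outcomes form a null set.
\<close>
definition renewal_count :: "(nat \<Rightarrow> 'a \<Rightarrow> real) \<Rightarrow> real \<Rightarrow> 'a \<Rightarrow> nat" where
  "renewal_count W t \<omega> = card {n. n \<ge> 1 \<and> (\<Sum>i<n. W i \<omega>) \<le> t}"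

definition fractional_poisson_process ::
  "'a measure \<Rightarrow> real \<Rightarrow> real \<Rightarrow> (real \<Rightarrow> 'a \<Rightarrow> nat) \<Rightarrow> bool" where
  "fractional_poisson_process M \<nu> l N \<longleftrightarrow>
    (\<exists>W :: nat \<Rightarrow> 'a \<Rightarrow> real.
       prob_space.indep_vars M (\<lambda>_. borel) W UNIV \<and>
       (\<forall>i. \<forall>\<omega>\<in>space M. W i \<omega> > 0) \<and>
       (\<forall>i. \<forall>t\<ge>0. measure M {\<omega>\<in>space M. W i \<omega> > t} = mittag_leffler \<nu> 1 (- l * t powr \<nu>)) \<and>
       (\<forall>t\<ge>0. \<forall>\<omega>\<in>space M. N t \<omega> = renewal_count W t \<omega>))"

text \<open>The increments are natural number subtractions; they do not truncate, as paths are monotone.\<close>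
definition poisson_process ::
  "'a measure \<Rightarrow> real \<Rightarrow> (real \<Rightarrow> 'a \<Rightarrow> nat) \<Rightarrow> bool" where
  "poisson_process M l N \<longleftrightarrow>
    (\<forall>t\<ge>0. N t \<in> measurable M (count_space UNIV)) \<and>
    (\<forall>\<omega>\<in>space M. N 0 \<omega> = 0 \<and> mono_on {0..} (\<lambda>t. N t \<omega>) \<and>
       (\<forall>t\<ge>0. continuous (at_right t) (\<lambda>s. real (N s \<omega>)))) \<and>
    (\<forall>n. \<forall>t :: nat \<Rightarrow> real. 0 \<le> t 0 \<and> (\<forall>i<n. t i \<le> t (Suc i)) \<longrightarrow>
       prob_space.indep_vars M (\<lambda>_. count_space UNIV)
         (\<lambda>i \<omega>. N (t (Suc i)) \<omega> - N (t i) \<omega>) {..<n}) \<and>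
    (\<forall>s t. 0 \<le> s \<and> s < t \<longrightarrow>
       distr M (count_space UNIV) (\<lambda>\<omega>. N t \<omega> - N s \<omega>) = measure_pmf (poisson_pmf (l * (t - s))))"

text \<open>Independence of two counting processes as random elements of the path space.\<close>
definition indep_processes ::
  "'a measure \<Rightarrow> (real \<Rightarrow> 'a \<Rightarrow> nat) \<Rightarrow> (real \<Rightarrow> 'a \<Rightarrow> nat) \<Rightarrow> bool" where
  "indep_processes M X Y \<longleftrightarrow>
    prob_space.indep_var M
      (PiM {0..} (\<lambda>_. count_space UNIV)) (\<lambda>\<omega>. \<lambda>t\<in>{0..}. X t \<omega>)
      (PiM {0..} (\<lambda>_. count_space UNIV)) (\<lambda>\<omega>. \<lambda>t\<in>{0..}. Y t \<omega>)"

definition hitting_time :: "(real \<Rightarrow> 'a \<Rightarrow> nat) \<Rightarrow> nat \<Rightarrow> 'a \<Rightarrow> real" where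
  "hitting_time N k \<omega> = Inf {t. 0 \<le> t \<and> N t \<omega> = k}"

definition composed_process ::
  "(real \<Rightarrow> 'a \<Rightarrow> nat) \<Rightarrow> (real \<Rightarrow> 'a \<Rightarrow> nat) \<Rightarrow> nat \<Rightarrow> 'a \<Rightarrow> nat" where
  "composed_process A N k \<omega> = A (hitting_time N k \<omega>) \<omega>"

text \<open>
  The terms of the series for the distribution of the composed process, as a power series in
  \<open>z = l\<^sub>\<beta> / l\<^sub>\<alpha> powr \<nu>\<close>. The radius of convergence is 1, and the series diverges for every real
  \<open>z \<ge> 1\<close>: its terms then do not tend to 0.
\<close>
definition state_series_term ::
  "real \<Rightarrow> nat \<Rightarrow> nat \<Rightarrow> 'b::real_normed_field \<Rightarrow> nat \<Rightarrow> 'b" where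
  "state_series_term \<nu> k r z j =
     of_real ((- real k) gchoose j) * z ^ (k + j) *
     of_real (Gamma (\<nu> * real (k + j) + real r) / Gamma (\<nu> * real (k + j)))"

text \<open>
  \<open>v\<close> is the value at \<open>c\<close> of the analytic continuation, to the plane punctured at \<open>-1\<close>, of the
  sum of the above power series. The continuation is unique because the punctured plane is
  connected; for \<open>\<bar>c\<bar> < 1\<close> the value is the ordinary sum of the series.
\<close>
definition continued_state_sum :: "real \<Rightarrow> nat \<Rightarrow> nat \<Rightarrow> real \<Rightarrow> real \<Rightarrow> bool" where
  "continued_state_sum \<nu> k r c v \<longleftrightarrow>
     (\<exists>F :: complex \<Rightarrow> complex.
        F holomorphic_on (- {-1}) \<and>
        (\<forall>z. norm z < 1 \<longrightarrow> state_series_term \<nu> k r z sums F z) \<and>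
        F (of_real c) = of_real v)"

end

theory Submission
  imports Defs "HOL-Complex_Analysis.Complex_Analysis"
begin

text \<open>
  The hitting time \<open>\<tau>\<close> of level \<open>k\<close> is the \<open>k\<close>-th epoch \<open>W 0 + \<dots> + W (k - 1)\<close>. Conditioning on
  \<open>\<tau>\<close>, the composed value is Poisson with mean \<open>l\<^sub>\<alpha> * \<tau>\<close>, so its probability generating
  function at \<open>u\<close> is \<open>E (exp (- l\<^sub>\<alpha> * (1 - u) * \<tau>))\<close> and its probabilities are
  \<open>E ((l\<^sub>\<alpha> * \<tau>) ^ r * exp (- l\<^sub>\<alpha> * \<tau>)) / r!\<close>, that is, derivatives at \<open>l\<^sub>\<alpha>\<close> of the Laplace transform of
  \<open>\<tau>\<close>. Integrating the Mittag-Leffler series against \<open>exp (- s * t)\<close> term by term gives the transform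
  \<open>(1 + s powr \<nu> / l\<^sub>\<beta>) ^ (- k)\<close> for large real \<open>s\<close>, the identity theorem extends it to \<open>Re s > 0\<close>,
  and continuity to \<open>Re s = 0\<close>. In the variable \<open>z = l\<^sub>\<beta> / s powr \<nu>\<close> the transform is
  \<open>(z / (1 + z)) ^ k\<close>; the binomial series for \<open>\<bar>z\<bar> < 1\<close>, differentiated term by term, produces the
  quotients of Gamma values.
\<close>

section \<open>Analytic continuation of the state series\<close>

text \<open>Passing from \<open>r\<close> to \<open>r + 1\<close> multiplies the quotient of Gamma values in the coefficient of
  \<open>z ^ n\<close> by \<open>\<nu> * n + r\<close>, which is the action of \<open>\<nu> * z * d/dz + r\<close>.\<close>
primrec state_function :: "real \<Rightarrow> nat \<Rightarrow> nat \<Rightarrow> complex \<Rightarrow> complex" where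
  "state_function \<nu> k 0 z = (z / (1 + z)) ^ k"
| "state_function \<nu> k (Suc r) z =
     of_real \<nu> * z * deriv (state_function \<nu> k r) z + of_nat r * state_function \<nu> k r z"

text \<open>The only singularity of the base case is the pole at -1, and multiplication by
  \<open>z\<close> and differentiation create no new one. This supplies the analytic continuation
  demanded by \<open>continued_state_sum\<close>.\<close>

lemma holomorphic_state_function: "state_function \<nu> k r holomorphic_on - {-1}"
proof (induction r)
  case 0
  have "1 + z \<noteq> 0" if "z \<noteq> -1" for z :: complex
    using that by (metis add.commute add_eq_0_iff)
  then have "(\<lambda>z. (z / (1 + z)) ^ k) holomorphic_on - {-1}"
    by (intro holomorphic_intros) auto
  then show ?case
    by (simp add: fun_eq_iff cong: holomorphic_cong)
next
  case (Suc r)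
  have "(\<lambda>z. of_real \<nu> * z * deriv (state_function \<nu> k r) z + of_nat r * state_function \<nu> k r z)
      holomorphic_on - {-1}"
    by (intro holomorphic_intros Suc holomorphic_deriv) auto
  then show ?case
    by (simp cong: holomorphic_cong)
qed

lemma of_real_gbinomial: "of_real (a gchoose n) = (of_real a gchoose n :: 'a::{real_field})"
  by (simp add: gbinomial_prod_rev)

text \<open>Lets a series with exponents \<open>k + j\<close> be read as an ordinary power series
  whose coefficients below \<open>k\<close> vanish.\<close>

lemma sums_shift_zeros_iff:
  fixes f :: "nat \<Rightarrow> 'a::real_normed_vector"
  assumes "\<And>n. n < k \<Longrightarrow> f n = 0"
  shows "(\<lambda>j. f (k + j)) sums s \<longleftrightarrow> f sums s"
  using sums_zero_iff_shift[of k f s] assms by (simp add: add.commute)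

text \<open>Termwise differentiation inside the disc. The extra factor \<open>z\<close> restores the
  exponent, so the coefficient of \<open>z ^ n\<close> is just multiplied by
  \<open>n\<close>.\<close>

lemma sums_deriv_power_series:
  fixes F :: "complex \<Rightarrow> complex"
  assumes F: "\<And>z. norm z < R \<Longrightarrow> (\<lambda>n. c n * z ^ n) sums F z" and z: "norm z < R"
  shows "(\<lambda>n. of_nat n * c n * z ^ n) sums (z * deriv F z)"
proof -
  have sm: "summable (\<lambda>n. c n * z ^ n)" if "norm z < R" for z
    using F[OF that] by (rule sums_summable)
  have "((\<lambda>z. \<Sum>n. c n * z ^ n) has_field_derivative (\<Sum>n. diffs c n * z ^ n)) (at z)"
    by (rule termdiffs_strong'[OF sm z])
  then have "(F has_field_derivative (\<Sum>n. diffs c n * z ^ n)) (at z)"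
    by (rule has_field_derivative_transform_within_open[of _ _ _ "ball 0 R"])
       (use z F in \<open>auto simp: sums_iff\<close>)
  then have "deriv F z = (\<Sum>n. diffs c n * z ^ n)"
    by (rule DERIV_imp_deriv)
  moreover have "summable (\<lambda>n. diffs c n * z ^ n)"
    by (rule termdiff_converges[OF z sm]) auto
  ultimately have "(\<lambda>n. diffs c n * z ^ n) sums deriv F z"
    by (simp add: summable_sums)
  then have "(\<lambda>n. z * (diffs c n * z ^ n)) sums (z * deriv F z)"
    by (rule sums_mult)
  then have "(\<lambda>n. of_nat (Suc n) * c (Suc n) * z ^ Suc n) sums (z * deriv F z)"
    by (simp add: diffs_def mult_ac)
  \<comment> \<open>Lowering the index by one adds only the term at 0, which vanishes because of the
    factor \<open>of_nat n\<close>.\<close>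
  then show ?thesis
    by (subst (asm) sums_Suc_iff) simp
qed

text \<open>Newton's binomial series for the exponent \<open>-k\<close>, multiplied by
  \<open>z ^ k\<close>; the Gamma quotient is 1 when \<open>r = 0\<close>.\<close>

lemma state_series_term_0_sums:
  fixes z :: complex
  assumes "norm z < 1"
  shows "(\<lambda>j. (of_real ((- real k) gchoose j)) * z ^ (k + j)) sums state_function \<nu> k 0 z"
proof -
  from assms have nz: "1 + z \<noteq> 0"
    by (metis add.commute add_eq_0_iff less_irrefl norm_minus_cancel norm_one)
  have "(\<lambda>n. ((- of_nat k) gchoose n) * z ^ n) sums (1 + z) powr (- of_nat k)"
    by (rule gen_binomial_complex[OF assms])
  also have "(1 + z) powr (- of_nat k) = 1 / (1 + z) ^ k"
    using nz by (simp add: powr_minus powr_nat inverse_eq_divide)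
  finally have "(\<lambda>n. z ^ k * (((- of_nat k) gchoose n) * z ^ n)) sums (z ^ k * (1 / (1 + z) ^ k))"
    by (rule sums_mult)
  then show ?thesis
    by (simp add: of_real_gbinomial power_add power_divide mult_ac)
qed

lemma pochhammer_series_sums:
  fixes z :: complex
  assumes "norm z < 1"
  shows "(\<lambda>j. of_real ((- real k) gchoose j) * z ^ (k + j) *
           of_real (pochhammer (\<nu> * real (k + j)) r)) sums state_function \<nu> k r z"
  using assms
proof (induction r arbitrary: z)
  case 0
  then show ?case using state_series_term_0_sums by simp
next
  case (Suc r)
  \<comment> \<open>The coefficients indexed by the exponent \<open>n = k + j\<close> and padded
    with zeros, as termwise differentiation requires.\<close>
  define c where "c n = (if n < k then 0 else complex_of_real
    (((- real k) gchoose (n - k)) * pochhammer (\<nu> * real n) r))" for n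
  have sums: "(\<lambda>n. c n * w ^ n) sums state_function \<nu> k r w" if "norm w < 1" for w
    using Suc.IH[OF that]
    by (subst sums_shift_zeros_iff[of k, symmetric]) (simp_all add: c_def mult_ac)
  have "(\<lambda>n. of_nat n * c n * z ^ n) sums (z * deriv (state_function \<nu> k r) z)"
    by (rule sums_deriv_power_series[OF sums Suc.prems])
  then have "(\<lambda>j. of_nat (k + j) * (of_real ((- real k) gchoose j) * z ^ (k + j) *
      of_real (pochhammer (\<nu> * real (k + j)) r))) sums (z * deriv (state_function \<nu> k r) z)"
    by (subst (asm) sums_shift_zeros_iff[of k, symmetric]) (simp_all add: c_def mult_ac)
  from sums_add[OF sums_mult[OF this, of "of_real \<nu>"] sums_mult[OF Suc.IH[OF Suc.prems], of "of_nat r"]]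
  show ?case
    by (simp add: pochhammer_Suc algebra_simps)
qed

text \<open>Since \<open>k\<close> is at least 1, all arguments \<open>\<nu> * real (k + j)\<close>
  are positive and avoid the poles of Gamma, so the quotient is a rising factorial.\<close>

lemma state_series_term_sums:
  fixes z :: complex
  assumes "norm z < 1" "0 < \<nu>" "1 \<le> k"
  shows "state_series_term \<nu> k r z sums state_function \<nu> k r z"
proof -
  have "Gamma (\<nu> * real (k + j) + real r) / Gamma (\<nu> * real (k + j)) =
      pochhammer (\<nu> * real (k + j)) r" for j
  proof -
    have "\<nu> * real (k + j) > 0" using assms by auto
    then have "\<nu> * real (k + j) \<notin> \<int>\<^sub>\<le>\<^sub>0" by (auto elim!: nonpos_Ints_cases)
    then show ?thesis by (simp add: pochhammer_Gamma)
  qed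
  then show ?thesis
    using pochhammer_series_sums[OF assms(1), of k \<nu> r]
    unfolding state_series_term_def[abs_def] by (simp only:)
qed

section \<open>Laplace transforms\<close>

text \<open>The exponential series of \<open>a * x\<close> dominates its single term of degree
  \<open>r\<close>. The bound is uniform in \<open>x\<close> and serves as the dominating constant
  below.\<close>

lemma power_mult_exp_minus_le:
  fixes a x :: real
  assumes "0 < a" "0 \<le> x"
  shows "x ^ r * exp (- a * x) \<le> fact r / a ^ r"
proof -
  have "(\<lambda>n. (a * x) ^ n /\<^sub>R fact n) sums exp (a * x)"
    by (rule exp_converges)
  then have "(\<Sum>n\<in>{r}. (a * x) ^ n /\<^sub>R fact n) \<le> exp (a * x)"
    using assms unfolding sums_iff by (metis (no_types, lifting) finite.emptyI finite.insertI
      fact_ge_zero inverse_nonnegative_iff_nonnegative mult_nonneg_nonneg less_imp_le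
      scaleR_nonneg_nonneg sum_le_suminf zero_le_power)
  then show ?thesis
    using assms by (simp add: exp_minus field_simps power_mult_distrib)
qed

text \<open>Mean value inequality on the convex half-plane \<open>a \<le> Re z\<close>, where the
  derivative in \<open>z\<close> is bounded by \<open>x * exp (- a * x)\<close>.\<close>

lemma norm_exp_minus_diff_le:
  fixes s t :: complex
  assumes "0 \<le> x" "a \<le> Re s" "a \<le> Re t"
  shows "norm (exp (- s * of_real x) - exp (- t * of_real x)) \<le> x * exp (- a * x) * norm (s - t)"
proof (rule field_differentiable_bound[of "{z. a \<le> Re z}"])
  show "convex {z. a \<le> Re z}"
    by (rule convex_halfspace_Re_ge)
  show "((\<lambda>z. exp (- z * of_real x)) has_field_derivative - of_real x * exp (- z * of_real x))
      (at z within {z. a \<le> Re z})" for z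
    by (auto intro!: derivative_eq_intros)
  show "norm (- complex_of_real x * exp (- z * of_real x)) \<le> x * exp (- a * x)"
    if "z \<in> {z. a \<le> Re z}" for z
    using that assms by (auto simp: norm_mult mult_left_mono mult_right_mono)
qed (use assms in auto)

section \<open>Exponentially weighted moments as holomorphic functions\<close>

context prob_space begin

text \<open>Up to the sign \<open>(-1) ^ r\<close> this is the \<open>r\<close>-th derivative of the
  Laplace transform of \<open>S\<close>. The argument is complex so that the identity theorem
  applies and complex \<open>u\<close> can be treated.\<close>

definition laplace_moment :: "('a \<Rightarrow> real) \<Rightarrow> nat \<Rightarrow> complex \<Rightarrow> complex" where
  "laplace_moment S r s = (LINT \<omega>|M. of_real (S \<omega>) ^ r * exp (- s * of_real (S \<omega>)))"

lemma laplace_moment_integrable: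
  assumes [measurable]: "S \<in> borel_measurable M" and "\<And>\<omega>. \<omega> \<in> space M \<Longrightarrow> 0 \<le> S \<omega>" "0 < Re s"
  shows "integrable M (\<lambda>\<omega>. of_real (S \<omega>) ^ r * exp (- s * of_real (S \<omega>)))"
proof (rule integrable_const_bound[where B = "fact r / Re s ^ r"])
  show "AE \<omega> in M. norm (of_real (S \<omega>) ^ r * exp (- s * of_real (S \<omega>))) \<le> fact r / Re s ^ r"
    using assms(2) power_mult_exp_minus_le[OF assms(3), of "S _" r]
    by (intro AE_I2) (simp add: norm_mult norm_power)
qed measurable

text \<open>Differentiation under the integral sign: dominated convergence is applied to the
  difference quotients along sequences tending to \<open>s\<close>.\<close>

lemma has_field_derivative_laplace_moment:
  assumes [measurable]: "S \<in> borel_measurable M"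
    and S: "\<And>\<omega>. \<omega> \<in> space M \<Longrightarrow> 0 \<le> S \<omega>" and s: "0 < Re s"
  shows "(laplace_moment S r has_field_derivative - laplace_moment S (Suc r) s) (at s)"
proof -
  \<comment> \<open>Staying to the right of half of \<open>Re s\<close> gives one decay rate, hence
    one constant bound, for all difference quotients.\<close>
  define a where "a = Re s / 2"
  define U where "U = {z. a < Re z}"
  have a: "0 < a" "a < Re s" using s by (auto simp: a_def)
  have "(laplace_moment S r has_field_derivative - laplace_moment S (Suc r) s) (at s within U)"
    unfolding has_field_derivative_iff tendsto_at_iff_sequentially
  proof (intro allI impI)
    fix X :: "nat \<Rightarrow> complex"
    assume X: "\<forall>i. X i \<in> U - {s}" "X \<longlonglongrightarrow> s"
    let ?g = "\<lambda>z \<omega>. of_real (S \<omega>) ^ r * exp (- z * of_real (S \<omega>)) :: complex"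
    let ?q = "\<lambda>i \<omega>. (?g (X i) \<omega> - ?g s \<omega>) / (X i - s)"
    have "(\<lambda>i. LINT \<omega>|M. ?q i \<omega>) \<longlonglongrightarrow>
      (LINT \<omega>|M. - (of_real (S \<omega>) ^ Suc r * exp (- s * of_real (S \<omega>))))"
    proof (rule integral_dominated_convergence[where w = "\<lambda>_. fact (Suc r) / a ^ Suc r"])
      show "AE \<omega> in M. (\<lambda>i. ?q i \<omega>) \<longlonglongrightarrow> - (of_real (S \<omega>) ^ Suc r * exp (- s * of_real (S \<omega>)))"
      proof (rule AE_I2)
        fix \<omega>
        have "((\<lambda>z. ?g z \<omega>) has_field_derivative
            - (of_real (S \<omega>) ^ Suc r * exp (- s * of_real (S \<omega>)))) (at s within U)"
          by (auto intro!: derivative_eq_intros)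
        then show "(\<lambda>i. ?q i \<omega>) \<longlonglongrightarrow> - (of_real (S \<omega>) ^ Suc r * exp (- s * of_real (S \<omega>)))"
          using X unfolding has_field_derivative_iff tendsto_at_iff_sequentially o_def by blast
      qed
      show "AE \<omega> in M. norm (?q i \<omega>) \<le> fact (Suc r) / a ^ Suc r" for i
      proof (rule AE_I2)
        fix \<omega> assume \<omega>: "\<omega> \<in> space M"
        have X': "X i \<noteq> s" "a < Re (X i)" using X by (auto simp: U_def)
        have "norm (?g (X i) \<omega> - ?g s \<omega>) =
            S \<omega> ^ r * norm (exp (- X i * of_real (S \<omega>)) - exp (- s * of_real (S \<omega>)))"
          using S[OF \<omega>] by (simp add: norm_mult norm_power flip: right_diff_distrib)
        also have "\<dots> \<le> S \<omega> ^ r * (S \<omega> * exp (- a * S \<omega>) * norm (X i - s))"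
          using S[OF \<omega>] X' a by (intro mult_left_mono norm_exp_minus_diff_le) auto
        also have "\<dots> = (S \<omega> ^ Suc r * exp (- a * S \<omega>)) * norm (X i - s)"
          by simp
        also have "\<dots> \<le> fact (Suc r) / a ^ Suc r * norm (X i - s)"
          using S[OF \<omega>] a by (intro mult_right_mono power_mult_exp_minus_le) auto
        finally show "norm (?q i \<omega>) \<le> fact (Suc r) / a ^ Suc r"
          using X' by (simp add: norm_divide divide_le_eq)
      qed
    qed auto
    moreover have "(LINT \<omega>|M. ?q i \<omega>) =
        (laplace_moment S r (X i) - laplace_moment S r s) / (X i - s)" for i
    proof -
      have "0 < Re (X i)" using X a by (auto simp: U_def intro: less_trans)
      then have "integrable M (?g (X i))" "integrable M (?g s)"
        using assms by (intro laplace_moment_integrable; simp)+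
      then show ?thesis
        by (simp add: laplace_moment_def)
    qed
    moreover have "(LINT \<omega>|M. - (of_real (S \<omega>) ^ Suc r * exp (- s * of_real (S \<omega>)))) =
        - laplace_moment S (Suc r) s"
      by (simp add: laplace_moment_def)
    ultimately show "((\<lambda>y. (laplace_moment S r y - laplace_moment S r s) / (y - s)) \<circ> X)
        \<longlonglongrightarrow> - laplace_moment S (Suc r) s"
      by (simp only: o_def)
  qed
  moreover have "open U" "s \<in> U"
    using a unfolding U_def by (auto intro: open_halfspace_Re_gt)
  ultimately show ?thesis
    by (simp add: at_within_open[of s U])
qed

lemma holomorphic_laplace_moment:
  assumes "S \<in> borel_measurable M" "\<And>\<omega>. \<omega> \<in> space M \<Longrightarrow> 0 \<le> S \<omega>"
  shows "laplace_moment S r holomorphic_on {s. 0 < Re s}"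
  using has_field_derivative_laplace_moment[OF assms]
  by (auto simp: holomorphic_on_open open_halfspace_Re_gt)

text \<open>For \<open>r = 0\<close> the integrand is bounded by 1 on the closed half-plane, so the
  limit may lie on the imaginary axis.\<close>

lemma tendsto_laplace_moment_0:
  assumes [measurable]: "S \<in> borel_measurable M" and S: "\<And>\<omega>. \<omega> \<in> space M \<Longrightarrow> 0 \<le> S \<omega>"
    and X: "\<And>i. 0 \<le> Re (X i)" "X \<longlonglongrightarrow> s"
  shows "(\<lambda>i. laplace_moment S 0 (X i)) \<longlonglongrightarrow> laplace_moment S 0 s"
  unfolding laplace_moment_def
proof (rule integral_dominated_convergence[where w = "\<lambda>_. 1"])
  show "AE \<omega> in M. norm (of_real (S \<omega>) ^ 0 * exp (- X i * of_real (S \<omega>))) \<le> 1" for i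
    using X S by (intro AE_I2) (simp add: zero_le_mult_iff)
  show "AE \<omega> in M. (\<lambda>i. of_real (S \<omega>) ^ 0 * exp (- X i * of_real (S \<omega>))) \<longlonglongrightarrow>
      of_real (S \<omega>) ^ 0 * exp (- s * of_real (S \<omega>))"
    using X by (intro AE_I2 tendsto_intros)
qed auto

end

text \<open>The argument of \<open>s\<close> lies strictly between -pi/2 and pi/2, and scaling it by
  \<open>\<nu> \<le> 1\<close> keeps it there.\<close>

lemma Re_powr_of_real_pos:
  fixes s :: complex
  assumes "0 < Re s" "0 < \<nu>" "\<nu> \<le> 1"
  shows "0 < Re (s powr of_real \<nu>)"
proof -
  have s: "s \<noteq> 0" using assms by auto
  have "\<bar>Im (Ln s)\<bar> < pi / 2"
    using assms Re_Ln_pos_lt[OF s] by blast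
  then have "\<bar>\<nu> * Im (Ln s)\<bar> < pi / 2"
    using assms mult_left_le_one_le[of "\<bar>Im (Ln s)\<bar>" \<nu>] by (simp add: abs_mult)
  then have "0 < cos (\<nu> * Im (Ln s))"
    by (intro cos_gt_zero_pi) auto
  then show ?thesis
    using s by (simp add: powr_def Re_exp)
qed

lemma Re_powr_of_real_nonneg:
  fixes s :: complex
  assumes "0 \<le> Re s" "0 < \<nu>" "\<nu> \<le> 1"
  shows "0 \<le> Re (s powr of_real \<nu>)"
proof (cases "s = 0")
  case False
  have "\<bar>Im (Ln s)\<bar> \<le> pi / 2"
    using assms Re_Ln_pos_le[OF False] by blast
  then have "\<bar>\<nu> * Im (Ln s)\<bar> \<le> pi / 2"
    using assms mult_left_le_one_le[of "\<bar>Im (Ln s)\<bar>" \<nu>] by (simp add: abs_mult)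
  then have "0 \<le> cos (\<nu> * Im (Ln s))"
    by (intro cos_ge_zero) auto
  then show ?thesis
    using False by (simp add: powr_def Re_exp)
qed auto

text \<open>The real part is at least 1; this is the denominator of the transform.\<close>

lemma one_plus_powr_divide_neq_0:
  fixes s :: complex
  assumes "0 \<le> Re s" "0 < \<nu>" "\<nu> \<le> 1" "0 < l"
  shows "1 + s powr of_real \<nu> / of_real l \<noteq> 0"
proof -
  have "0 \<le> Re (s powr of_real \<nu> / of_real l)"
    using Re_powr_of_real_nonneg[OF assms(1-3)] assms(4) by simp
  then have "Re (1 + s powr of_real \<nu> / of_real l) \<noteq> 0" by simp
  then show ?thesis by force
qed

context prob_space begin

text \<open>With \<open>c = l / s powr \<nu>\<close> one has \<open>s * dc/ds = - \<nu> * c\<close>, so the recursion of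
  \<^const>\<open>state_function\<close> mirrors differentiation of the Laplace transform.\<close>
lemma laplace_moment_eq_state_function:
  assumes meas: "S \<in> borel_measurable M" and S: "\<And>\<omega>. \<omega> \<in> space M \<Longrightarrow> 0 \<le> S \<omega>"
    and \<nu>: "0 < \<nu>" "\<nu> \<le> 1" and l: "0 < l"
    and L: "\<And>s. 0 < Re s \<Longrightarrow> laplace_moment S 0 s = (1 / (1 + s powr of_real \<nu> / of_real l)) ^ k"
    and s: "0 < Re s"
  shows "s ^ r * laplace_moment S r s = state_function \<nu> k r (of_real l * s powr - of_real \<nu>)"
  using s
proof (induction r arbitrary: s)
  case 0
  have "s powr of_real \<nu> \<noteq> 0"
    using 0 by auto
  moreover have "1 + s powr of_real \<nu> / of_real l \<noteq> 0"
    using 0 \<nu> l by (intro one_plus_powr_divide_neq_0) auto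
  ultimately have "1 / (1 + s powr of_real \<nu> / of_real l) =
      (of_real l * s powr - of_real \<nu>) / (1 + of_real l * s powr - of_real \<nu>)"
    using l by (simp add: powr_minus field_simps)
  then show ?case
    using L[OF 0] by simp
next
  case (Suc r)
  let ?c = "\<lambda>s. of_real l * s powr - of_real \<nu> :: complex"
  have s: "0 < Re s" by fact
  have s0: "s \<noteq> 0" "s \<notin> \<real>\<^sub>\<le>\<^sub>0" using s by (auto elim!: nonpos_Reals_cases)
  have "0 < Re (s powr of_real \<nu>)" by (rule Re_powr_of_real_pos[OF s \<nu>])
  \<comment> \<open>The singularity of \<open>state_function\<close> is not met: it would force
    \<open>s powr \<nu>\<close> to be a negative real.\<close>
  have c: "?c s \<noteq> -1"
  proof
    assume "?c s = -1"
    then have "s powr of_real \<nu> = - of_real l"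
      using s0 by (simp add: powr_minus field_simps)
    then show False
      using \<open>0 < Re (s powr of_real \<nu>)\<close> l by simp
  qed
  \<comment> \<open>The same function is differentiated twice, by the product rule here and by the
    chain rule in fact 2; comparing the results yields the recursion.\<close>
  have "((\<lambda>s. s ^ r * laplace_moment S r s) has_field_derivative
     of_nat r * s ^ (r - 1) * laplace_moment S r s - s ^ r * laplace_moment S (Suc r) s) (at s)"
    by (auto intro!: derivative_eq_intros has_field_derivative_laplace_moment[OF meas S s])
  then have 1: "((\<lambda>s. state_function \<nu> k r (?c s)) has_field_derivative
     of_nat r * s ^ (r - 1) * laplace_moment S r s - s ^ r * laplace_moment S (Suc r) s) (at s)"
    by (rule has_field_derivative_transform_within_open[of _ _ _ "{s. 0 < Re s}"])
       (use Suc.IH s in \<open>auto simp: open_halfspace_Re_gt\<close>)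
  have "(state_function \<nu> k r has_field_derivative deriv (state_function \<nu> k r) (?c s)) (at (?c s))"
    by (rule holomorphic_derivI[OF holomorphic_state_function]) (use c in auto)
  moreover have "(?c has_field_derivative - of_real \<nu> * ?c s / s) (at s)"
    using s0 by (auto intro!: derivative_eq_intros simp: powr_diff)
  ultimately have 2: "((\<lambda>s. state_function \<nu> k r (?c s)) has_field_derivative
      deriv (state_function \<nu> k r) (?c s) * (- of_real \<nu> * ?c s / s)) (at s)"
    by (rule DERIV_chain2)
  have "s * (of_nat r * s ^ (r - 1) * laplace_moment S r s - s ^ r * laplace_moment S (Suc r) s)
      = s * (deriv (state_function \<nu> k r) (?c s) * (- of_real \<nu> * ?c s / s))"
    using DERIV_unique[OF 1 2] by simp
  also have "\<dots> = - of_real \<nu> * ?c s * deriv (state_function \<nu> k r) (?c s)"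
    using s0 by simp
  \<comment> \<open>The case \<open>r = 0\<close> is separate because of the truncated exponent
    \<open>r - 1\<close>; the factor \<open>of_nat r\<close> is 0 there.\<close>
  finally have "s ^ Suc r * laplace_moment S (Suc r) s = of_real \<nu> * ?c s *
      deriv (state_function \<nu> k r) (?c s) + of_nat r * (s ^ r * laplace_moment S r s)"
    by (cases r) (auto simp: algebra_simps)
  then show ?case
    using Suc.IH[OF s] by simp
qed

end

section \<open>The Laplace transform of the Mittag-Leffler distribution\<close>

text \<open>Euler's integral for Gamma after the substitution
  \<open>t \<mapsto> s * t\<close>.\<close>

lemma has_bochner_integral_powr_exp:
  fixes p s :: real
  assumes p: "0 \<le> p" and s: "0 < s"
  shows "has_bochner_integral lborel (\<lambda>t. indicator {0<..} t * (t powr p * exp (- s * t)))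
    (Gamma (p + 1) / s powr (p + 1))"
proof (rule has_bochner_integral_nn_integral)
  let ?f = "\<lambda>t. indicator {0<..} t * (t powr p * exp (- s * t)) :: real"
  let ?g = "\<lambda>t. ennreal (indicator {0..} t * t powr p / exp t)"
  have "ennreal (Gamma (p + 1)) = (\<integral>\<^sup>+t. ?g t \<partial>lborel)"
    using Gamma_conv_nn_integral_real[of "p + 1"] p by simp
  also have "\<dots> = ennreal s * (\<integral>\<^sup>+t. ?g (0 + s * t) \<partial>lborel)"
    using s by (subst nn_integral_real_affine[of _ s 0]) auto
  also have "(\<integral>\<^sup>+t. ?g (0 + s * t) \<partial>lborel) = (\<integral>\<^sup>+t. ennreal (s powr p) * ennreal (?f t) \<partial>lborel)"
  proof (intro nn_integral_cong)
    fix t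
    \<comment> \<open>The indicators differ at \<open>t = 0\<close>, but both sides vanish there
      since \<open>0 powr p = 0\<close>, even for \<open>p = 0\<close>.\<close>
    show "?g (0 + s * t) = ennreal (s powr p) * ennreal (?f t)"
      using s by (cases "0 < t")
        (auto simp: powr_mult exp_minus field_simps zero_le_mult_iff indicator_def simp flip: ennreal_mult)
  qed
  also have "\<dots> = ennreal (s powr p) * (\<integral>\<^sup>+t. ennreal (?f t) \<partial>lborel)"
    by (rule nn_integral_cmult) measurable
  finally have eq: "ennreal (Gamma (p + 1)) =
      ennreal s * (ennreal (s powr p) * (\<integral>\<^sup>+t. ennreal (?f t) \<partial>lborel))" .
  \<comment> \<open>The integral is not yet known to be finite, so its factor is removed by
    multiplying with the reciprocal.\<close>
  have "ennreal (1 / s powr (p + 1)) * (ennreal s * ennreal (s powr p)) =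
      ennreal (1 / s powr (p + 1) * (s * s powr p))"
    using s by (simp only: ennreal_mult mult_nonneg_nonneg powr_ge_zero less_imp_le zero_le_divide_1_iff)
  also have "1 / s powr (p + 1) * (s * s powr p) = 1"
    using s by (simp add: powr_add)
  finally have "(\<integral>\<^sup>+t. ennreal (?f t) \<partial>lborel) =
      ennreal (1 / s powr (p + 1)) * (ennreal s * ennreal (s powr p)) *
        (\<integral>\<^sup>+t. ennreal (?f t) \<partial>lborel)"
    by simp
  also have "\<dots> = ennreal (1 / s powr (p + 1)) * ennreal (Gamma (p + 1))"
    unfolding eq by (simp only: mult.assoc)
  finally show "(\<integral>\<^sup>+t. ennreal (?f t) \<partial>lborel) = ennreal (Gamma (p + 1) / s powr (p + 1))"
    using p by (simp flip: ennreal_mult)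
  show "0 \<le> Gamma (p + 1) / s powr (p + 1)"
    using p by simp
qed auto

text \<open>The sum of the norms has finite integral by monotone convergence, hence is finite almost
  everywhere.\<close>

lemma AE_summable_norm_if_summable_integral_norm:
  fixes f :: "nat \<Rightarrow> 'a \<Rightarrow> 'b::{banach, second_countable_topology}"
  assumes f: "\<And>i. integrable M (f i)" and sum: "summable (\<lambda>i. \<integral>x. norm (f i x) \<partial>M)"
  shows "AE x in M. summable (\<lambda>i. norm (f i x))"
proof -
  have [measurable]: "f i \<in> borel_measurable M" for i
    using f by auto
  have "(\<integral>\<^sup>+x. (\<Sum>i. ennreal (norm (f i x))) \<partial>M) = (\<Sum>i. \<integral>\<^sup>+x. ennreal (norm (f i x)) \<partial>M)"
    by (rule nn_integral_suminf) measurable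
  also have "\<dots> = (\<Sum>i. ennreal (\<integral>x. norm (f i x) \<partial>M))"
    using f by (intro suminf_cong nn_integral_eq_integral) auto
  also have "\<dots> \<noteq> \<infinity>"
    using sum by (subst suminf_ennreal2) auto
  finally have "AE x in M. (\<Sum>i. ennreal (norm (f i x))) \<noteq> \<infinity>"
    by (intro nn_integral_PInf_AE) auto
  then show ?thesis
    by eventually_elim (auto intro: summable_suminf_not_top)
qed

text \<open>Termwise integration cancels the Gamma values and leaves a geometric series of ratio
  \<open>- l / s powr \<nu>\<close>; the assumption on \<open>l\<close> says exactly that this ratio
  has modulus below 1.\<close>

lemma has_bochner_integral_mittag_leffler:
  fixes \<nu> l s :: real
  assumes \<nu>: "0 < \<nu>" and l: "0 < l" and s: "0 < s" and ls: "l < s powr \<nu>"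
  shows "has_bochner_integral lborel
    (\<lambda>t. indicator {0<..} t * (mittag_leffler \<nu> 1 (- l * t powr \<nu>) * exp (- s * t)))
    (1 / (s * (1 + l / s powr \<nu>)))"
proof -
  define f where "f r t = (- l) ^ r / Gamma (\<nu> * real r + 1) *
    (indicator {0<..} t * (t powr (\<nu> * real r) * exp (- s * t)))" for r and t :: real
  have G: "0 < Gamma (\<nu> * real r + 1)" for r
    using \<nu> by (intro Gamma_real_pos) (simp add: add_nonneg_pos)
  have s_powr: "s powr (\<nu> * real r + 1) = s * (s powr \<nu>) ^ r" for r
    using s by (simp add: powr_add powr_powr[symmetric] powr_realpow)
  have int: "has_bochner_integral lborel (f r) (1 / s * (- l / s powr \<nu>) ^ r)" for r
  proof -
    have "has_bochner_integral lborel (f r) ((- l) ^ r / Gamma (\<nu> * real r + 1) *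
        (Gamma (\<nu> * real r + 1) / s powr (\<nu> * real r + 1)))"
      unfolding f_def using \<nu> s
      by (intro has_bochner_integral_mult_right has_bochner_integral_powr_exp) auto
    then show ?thesis
      using G[of r] unfolding s_powr by (simp only: power_divide) simp
  qed
  have norm_f: "norm (f r t) = l ^ r / Gamma (\<nu> * real r + 1) *
    (indicator {0<..} t * (t powr (\<nu> * real r) * exp (- s * t)))" for r t
    using G[of r] l by (simp add: f_def abs_mult power_abs)
  have int_norm: "(LINT t|lborel. norm (f r t)) = 1 / s * (l / s powr \<nu>) ^ r" for r
  proof -
    have "has_bochner_integral lborel (\<lambda>t. norm (f r t)) (l ^ r / Gamma (\<nu> * real r + 1) *
        (Gamma (\<nu> * real r + 1) / s powr (\<nu> * real r + 1)))"
      unfolding norm_f using \<nu> s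
      by (intro has_bochner_integral_mult_right has_bochner_integral_powr_exp) auto
    then show ?thesis
      using G[of r] unfolding s_powr
      by (simp add: power_divide mult_ac has_bochner_integral_integral_eq)
  qed
  have q: "\<bar>l / s powr \<nu>\<bar> < 1" "\<bar>- l / s powr \<nu>\<bar> < 1"
    using l ls s by (auto simp: pos_divide_less_eq)
  have integrable: "integrable lborel (f r)" for r
    using int by (rule integrable.intros)
  have summable: "summable (\<lambda>r. LINT t|lborel. norm (f r t))"
    unfolding int_norm using q by (intro summable_mult summable_geometric) auto
  note AE = AE_summable_norm_if_summable_integral_norm[OF integrable summable]
  have "(\<Sum>r. f r t) = indicator {0<..} t * (mittag_leffler \<nu> 1 (- l * t powr \<nu>) * exp (- s * t))"
    if "summable (\<lambda>r. norm (f r t))" for t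
  proof (cases "0 < t")
    case True
    then have pow: "(- l * t powr \<nu>) ^ r = (- l) ^ r * t powr (\<nu> * real r)" for r
      by (simp only: power_mult_distrib) (simp add: powr_powr[symmetric] powr_realpow)
    have f_t: "f r t = (- l * t powr \<nu>) ^ r / Gamma (\<nu> * real r + 1) * exp (- s * t)" for r
      unfolding f_def pow using True by simp
    \<comment> \<open>Removing the exponential shows that the Mittag-Leffler series itself converges
      at \<open>t\<close>, without any growth estimate for Gamma.\<close>
    have "f r t * exp (s * t) = (- l * t powr \<nu>) ^ r / Gamma (\<nu> * real r + 1)" for r
      unfolding f_t by (simp add: mult.assoc mult_exp_exp)
    with summable_mult2[OF summable_norm_cancel[OF that], of "exp (s * t)"]
    have "summable (\<lambda>r. (- l * t powr \<nu>) ^ r / Gamma (\<nu> * real r + 1))"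
      by (simp only:)
    then show ?thesis
      using True unfolding f_t by (subst suminf_mult2[symmetric]) (auto simp: mittag_leffler_def)
  qed (simp add: f_def)
  with AE have AE_eq: "AE t in lborel. (\<Sum>r. f r t) =
      indicator {0<..} t * (mittag_leffler \<nu> 1 (- l * t powr \<nu>) * exp (- s * t))"
    by auto
  have [measurable]: "(\<lambda>t. mittag_leffler \<nu> 1 (- l * t powr \<nu>)) \<in> borel_measurable lborel"
    unfolding mittag_leffler_def by measurable
  have "has_bochner_integral lborel (\<lambda>t. \<Sum>r. f r t) (\<Sum>r. LINT t|lborel. f r t)"
    using integrable_suminf[OF integrable AE summable] integral_suminf[OF integrable AE summable]
    by (simp add: has_bochner_integral_iff)
  also have "(\<Sum>r. LINT t|lborel. f r t) = (\<Sum>r. 1 / s * (- l / s powr \<nu>) ^ r)"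
    by (simp only: has_bochner_integral_integral_eq[OF int])
  also have "\<dots> = 1 / s * (1 / (1 - (- l / s powr \<nu>)))"
    using q by (subst suminf_mult) (auto simp only: suminf_geometric summable_geometric real_norm_def)
  also have "\<dots> = 1 / (s * (1 + l / s powr \<nu>))"
    by simp
  finally have sum: "has_bochner_integral lborel (\<lambda>t. \<Sum>r. f r t) (1 / (s * (1 + l / s powr \<nu>)))" .
  have [measurable]: "f r \<in> borel_measurable lborel" for r
    using integrable by (rule borel_measurable_integrable)
  have meas: "(\<lambda>t. \<Sum>r. f r t) \<in> borel_measurable lborel"
    "(\<lambda>t. indicator {0<..} t * (mittag_leffler \<nu> 1 (- l * t powr \<nu>) * exp (- s * t)))
      \<in> borel_measurable lborel"
    by measurable
  show ?thesis
    using has_bochner_integral_cong_AE[OF meas AE_eq] sum by blast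
qed

section \<open>From the tail of a positive variable to its Laplace transform\<close>

context prob_space begin

text \<open>Write \<open>1 - exp (- s * W \<omega>)\<close> as the integral of
  \<open>s * exp (- s * t)\<close> over \<open>0 < t < W \<omega>\<close> and exchange the integrals
  by Tonelli.\<close>

lemma laplace_transform_eq_tail_integral:
  fixes W :: "'a \<Rightarrow> real"
  assumes W [measurable]: "W \<in> borel_measurable M" and pos: "\<And>\<omega>. \<omega> \<in> space M \<Longrightarrow> 0 < W \<omega>"
    and s: "0 < s"
    and tail: "has_bochner_integral lborel
      (\<lambda>t. indicator {0<..} t * (prob {\<omega>\<in>space M. t < W \<omega>} * exp (- s * t))) I"
  shows "(LINT \<omega>|M. exp (- s * W \<omega>)) = 1 - s * I"
proof -
  interpret P: pair_sigma_finite M lborel ..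
  let ?k = "\<lambda>\<omega> t. ennreal (if 0 < t \<and> t < W \<omega> then s * exp (- s * t) else 0)"
  have int_exp: "integrable M (\<lambda>\<omega>. exp (- s * W \<omega>))"
    using pos s by (intro integrable_const_bound[where B = 1] AE_I2) (auto simp: less_imp_le)
  have "ennreal (LINT \<omega>|M. 1 - exp (- s * W \<omega>)) = (\<integral>\<^sup>+\<omega>. ennreal (1 - exp (- s * W \<omega>)) \<partial>M)"
    using pos s int_exp
    by (intro nn_integral_eq_integral[symmetric] AE_I2) (auto simp: less_imp_le)
  also have "\<dots> = (\<integral>\<^sup>+\<omega>. (\<integral>\<^sup>+t. ?k \<omega> t \<partial>lborel) \<partial>M)"
  proof (rule nn_integral_cong)
    fix \<omega> assume \<omega>: "\<omega> \<in> space M"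
    have "(\<integral>\<^sup>+t. ?k \<omega> t \<partial>lborel) = (\<integral>\<^sup>+t. ennreal (s * exp (- s * t)) * indicator {0..W \<omega>} t \<partial>lborel)"
      using AE_lborel_singleton[of 0] AE_lborel_singleton[of "W \<omega>"]
      by (intro nn_integral_cong_AE, eventually_elim) (auto simp: indicator_def)
    also have "\<dots> = ennreal (- exp (- s * W \<omega>) - - exp (- s * 0))"
      using pos[OF \<omega>] s
      by (intro nn_integral_FTC_Icc) (auto intro!: derivative_eq_intros)
    finally show "ennreal (1 - exp (- s * W \<omega>)) = (\<integral>\<^sup>+t. ?k \<omega> t \<partial>lborel)"
      by simp
  qed
  also have "\<dots> = (\<integral>\<^sup>+t. (\<integral>\<^sup>+\<omega>. ?k \<omega> t \<partial>M) \<partial>lborel)"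
    by (rule P.Fubini'[symmetric]) measurable
  also have "\<dots> = (\<integral>\<^sup>+t. ennreal (s * (indicator {0<..} t *
      (prob {\<omega>\<in>space M. t < W \<omega>} * exp (- s * t)))) \<partial>lborel)"
  proof (rule nn_integral_cong)
    fix t :: real
    have "(\<integral>\<^sup>+\<omega>. ?k \<omega> t \<partial>M) = (\<integral>\<^sup>+\<omega>. ennreal (indicator {0<..} t * (s * exp (- s * t))) *
        indicator {\<omega>\<in>space M. t < W \<omega>} \<omega> \<partial>M)"
      by (intro nn_integral_cong) (auto simp: indicator_def)
    also have "\<dots> = ennreal (indicator {0<..} t * (s * exp (- s * t))) *
        emeasure M {\<omega>\<in>space M. t < W \<omega>}"
      by (rule nn_integral_cmult_indicator) measurable
    also have "\<dots> = ennreal (s * (indicator {0<..} t * (prob {\<omega>\<in>space M. t < W \<omega>} * exp (- s * t))))"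
      using s by (simp add: emeasure_eq_measure mult_ac flip: ennreal_mult)
    finally show "(\<integral>\<^sup>+\<omega>. ?k \<omega> t \<partial>M) = \<dots>" .
  qed
  also have "\<dots> = ennreal (s * I)"
    using s has_bochner_integral_mult_right[OF tail, of s]
    by (subst nn_integral_eq_integral) (auto simp: has_bochner_integral_iff)
  finally have "(LINT \<omega>|M. 1 - exp (- s * W \<omega>)) = s * I"
  proof (subst (asm) ennreal_inj)
    show "0 \<le> (LINT \<omega>|M. 1 - exp (- s * W \<omega>))"
      using pos s by (intro integral_nonneg_AE AE_I2) (auto simp: less_imp_le)
    show "0 \<le> s * I"
      using s tail by (auto intro!: mult_nonneg_nonneg integral_nonneg_AE simp: has_bochner_integral_iff)
  qed
  then show ?thesis
    using int_exp by (simp add: prob_space)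
qed

end

section \<open>Counting processes at random times\<close>

text \<open>By monotonicity the counted indices form an initial segment of the positive
  integers.\<close>

lemma card_epochs_eq_iff:
  fixes S :: "nat \<Rightarrow> real"
  assumes S: "strict_mono S" and k: "1 \<le> k"
  shows "card {n. 1 \<le> n \<and> S n \<le> t} = k \<longleftrightarrow> S k \<le> t \<and> t < S (Suc k)"
proof
  let ?A = "{n. 1 \<le> n \<and> S n \<le> t}"
  assume card: "card ?A = k"
  \<comment> \<open>An infinite set has \<open>card\<close> 0, so \<open>k \<ge> 1\<close> excludes
    it.\<close>
  with k have fin: "finite ?A" and "?A \<noteq> {}"
    by (auto intro: card_ge_0_finite simp del: Collect_empty_eq)
  then have "Max ?A \<in> ?A" by (rule Max_in)
  have "?A = {1..Max ?A}"
  proof (intro equalityI subsetI)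
    fix n assume "n \<in> {1..Max ?A}"
    then have "S n \<le> S (Max ?A)"
      using S by (simp add: strict_mono_less_eq)
    then show "n \<in> ?A"
      using \<open>Max ?A \<in> ?A\<close> \<open>n \<in> {1..Max ?A}\<close> by auto
  next
    fix n assume "n \<in> ?A"
    then show "n \<in> {1..Max ?A}" using fin by auto
  qed
  then have A: "?A = {1..k}"
    using card by (metis card_atLeastAtMost diff_Suc_1 Suc_eq_plus1)
  then have "k \<in> ?A" "Suc k \<notin> ?A"
    using k by auto
  then show "S k \<le> t \<and> t < S (Suc k)" by auto
next
  assume t: "S k \<le> t \<and> t < S (Suc k)"
  have "S n \<le> t \<longleftrightarrow> n \<le> k" for n
  proof
    assume "S n \<le> t"
    with t have "S n < S (Suc k)" by linarith
    then show "n \<le> k" using S by (simp add: strict_mono_less)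
  next
    assume "n \<le> k"
    then have "S n \<le> S k" using S by (simp add: strict_mono_less_eq)
    then show "S n \<le> t" using t by linarith
  qed
  then have "{n. 1 \<le> n \<and> S n \<le> t} = {1..k}"
    by (simp only: atLeastAtMost_def atLeast_def atMost_def Collect_conj_eq)
  then show "card {n. 1 \<le> n \<and> S n \<le> t} = k" by simp
qed

lemma Inf_hitting_set_eq:
  assumes "0 \<le> a" "a < (b::real)" "\<And>t. 0 \<le> t \<Longrightarrow> N t = k \<longleftrightarrow> a \<le> t \<and> t < b"
  shows "Inf {t. 0 \<le> t \<and> N t = k} = a"
proof -
  have "{t. 0 \<le> t \<and> N t = k} = {t. 0 \<le> t \<and> a \<le> t \<and> t < b}"
    using assms(3) by (intro Collect_cong conj_cong) auto
  also have "\<dots> = {a..<b}"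
    using assms(1) by auto
  finally have "{t. 0 \<le> t \<and> N t = k} = {a..<b}" .
  then show ?thesis using assms by simp
qed

section \<open>Evaluation of a process at an independent random time\<close>

context prob_space begin

text \<open>Independence of the path \<open>P\<close> and the time \<open>S\<close> is expressed by the product of their
  distributions, since \<^const>\<open>indep_var\<close> requires variables with values in the same type.
  The infimum may be restricted to rational times, which makes it a measurable functional of
  the path.\<close>
lemma
  fixes N :: "real \<Rightarrow> 'a \<Rightarrow> nat" and S S' :: "'a \<Rightarrow> real"
  assumes indep: "indep_var K P (PiM {0..} (\<lambda>_. count_space UNIV)) (\<lambda>\<omega>. \<lambda>t\<in>{0..}. N t \<omega>)"
    and S: "\<And>\<omega>. \<omega> \<in> space M \<Longrightarrow> 0 \<le> S \<omega> \<and> S \<omega> < S' \<omega>"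
    and N: "\<And>\<omega> t. \<omega> \<in> space M \<Longrightarrow> 0 \<le> t \<Longrightarrow> N t \<omega> = k \<longleftrightarrow> S \<omega> \<le> t \<and> t < S' \<omega>"
  shows measurable_interval_start: "S \<in> borel_measurable M"
    and distr_pair_interval_start:
      "distr M K P \<Otimes>\<^sub>M distr M borel S = distr M (K \<Otimes>\<^sub>M borel) (\<lambda>\<omega>. (P \<omega>, S \<omega>))"
proof -
  let ?N = "\<lambda>\<omega>. \<lambda>t\<in>{0..}. N t \<omega>"
  let ?Q = "PiM {0..} (\<lambda>_. count_space UNIV) :: (real \<Rightarrow> nat) measure"
  \<comment> \<open>The value \<open>\<infinity>\<close> discards times off level \<open>k\<close>,
    leaving the infimum of the rational times at level \<open>k\<close>.\<close>
  define g where "g y = real_of_ereal (INF q\<in>\<rat> \<inter> {0..}. if y q = k then ereal q else \<infinity>)"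
    for y :: "real \<Rightarrow> nat"
  have [measurable]: "g \<in> borel_measurable (PiM {0..} (\<lambda>_. count_space UNIV))"
  proof -
    have "(\<lambda>y. if y q = k then ereal q else \<infinity>) \<in> borel_measurable (PiM {0..} (\<lambda>_. count_space UNIV))"
      if "q \<in> \<rat> \<inter> {0..}" for q
    proof -
      have [measurable]: "(\<lambda>y. y q) \<in> measurable (PiM {0..} (\<lambda>_. count_space UNIV)) (count_space UNIV)"
        using that by (intro measurable_component_singleton) auto
      show ?thesis by measurable
    qed
    then show ?thesis
      unfolding g_def by (intro borel_measurable_real_of_ereal borel_measurable_INF)
        (auto intro: countable_rat)
  qed
  have g: "g (\<lambda>t\<in>{0..}. N t \<omega>) = S \<omega>" if \<omega>: "\<omega> \<in> space M" for \<omega>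
  proof -
    let ?f = "\<lambda>q. if (\<lambda>t\<in>{0..}. N t \<omega>) q = k then ereal q else \<infinity>"
    have "(INF q\<in>\<rat> \<inter> {0..}. ?f q) = ereal (S \<omega>)"
    proof (rule antisym)
      show "ereal (S \<omega>) \<le> (INF q\<in>\<rat> \<inter> {0..}. ?f q)"
        using N[OF \<omega>] by (intro INF_greatest) auto
      show "(INF q\<in>\<rat> \<inter> {0..}. ?f q) \<le> ereal (S \<omega>)"
      proof (rule ccontr)
        assume "\<not> (INF q\<in>\<rat> \<inter> {0..}. ?f q) \<le> ereal (S \<omega>)"
        then obtain z where z: "S \<omega> < z" "ereal z < (INF q\<in>\<rat> \<inter> {0..}. ?f q)"
          using ereal_dense2[of "ereal (S \<omega>)"] by (auto simp: not_le)
        \<comment> \<open>The level set is an interval of positive length starting at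
          \<open>S \<omega>\<close>, so it contains rationals arbitrarily close to its left
          end.\<close>
        obtain q where q: "q \<in> \<rat>" "S \<omega> < q" "q < min z (S' \<omega>)"
          using Rats_dense_in_real[of "S \<omega>" "min z (S' \<omega>)"] z S[OF \<omega>] by auto
        then have "?f q = ereal q"
          using N[OF \<omega>, of q] S[OF \<omega>] by auto
        moreover have "(INF q\<in>\<rat> \<inter> {0..}. ?f q) \<le> ?f q"
          using q S[OF \<omega>] by (intro INF_lower) auto
        ultimately have "(INF q\<in>\<rat> \<inter> {0..}. ?f q) \<le> ereal q" by simp
        also have "\<dots> < ereal z" using q by simp
        finally show False using z by simp
      qed
    qed
    then show ?thesis by (simp add: g_def)
  qed
  have [measurable]: "P \<in> measurable M K" "?N \<in> measurable M ?Q"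
    and distr: "distr M K P \<Otimes>\<^sub>M distr M ?Q ?N = distr M (K \<Otimes>\<^sub>M ?Q) (\<lambda>\<omega>. (P \<omega>, ?N \<omega>))"
    using indep unfolding indep_var_distribution_eq by blast+
  have "(\<lambda>\<omega>. g (?N \<omega>)) \<in> borel_measurable M"
    by measurable
  also have "?this \<longleftrightarrow> S \<in> borel_measurable M"
    by (rule measurable_cong) (rule g)
  finally show [measurable]: "S \<in> borel_measurable M" .
  \<comment> \<open>As the time is a function of the path, its law is an image of the path law, and
    the product form is inherited.\<close>
  have distr_S: "distr M borel S = distr (distr M ?Q ?N) borel g"
    by (subst distr_distr) (auto intro!: distr_cong simp: g)
  interpret S: prob_space "distr M borel S"
    by (rule prob_space_distr) measurable
  have "distr M K P \<Otimes>\<^sub>M distr M borel S =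
      distr (distr M K P) K (\<lambda>x. x) \<Otimes>\<^sub>M distr (distr M ?Q ?N) borel g"
    by (simp add: distr_S distr_id2)
  also have "\<dots> = distr (distr M K P \<Otimes>\<^sub>M distr M ?Q ?N) (K \<Otimes>\<^sub>M borel) (\<lambda>(x, y). (x, g y))"
    using S.sigma_finite_measure_axioms by (intro pair_measure_distr) (auto simp: distr_S)
  also have "\<dots> = distr M (K \<Otimes>\<^sub>M borel) (\<lambda>\<omega>. (P \<omega>, S \<omega>))"
    unfolding distr by (subst distr_distr) (auto intro!: distr_cong simp: g)
  finally show "distr M K P \<Otimes>\<^sub>M distr M borel S = distr M (K \<Otimes>\<^sub>M borel) (\<lambda>\<omega>. (P \<omega>, S \<omega>))" .
qed

text \<open>On a time grid the evaluation is measurable and Fubini reduces the expectation to fixed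
  times. Right-continuity of the paths and continuity of \<open>h\<close> carry both facts to the
  limit.\<close>

lemma
  fixes X :: "real \<Rightarrow> 'a \<Rightarrow> nat" and f :: "nat \<Rightarrow> complex"
  assumes rv [measurable]:
      "(\<lambda>\<omega>. \<lambda>t\<in>{0..}. X t \<omega>) \<in> measurable M (PiM {0..} (\<lambda>_. count_space UNIV))"
      "S \<in> borel_measurable M"
    and indep: "distr M (PiM {0..} (\<lambda>_. count_space UNIV)) (\<lambda>\<omega>. \<lambda>t\<in>{0..}. X t \<omega>) \<Otimes>\<^sub>M distr M borel S =
      distr M (PiM {0..} (\<lambda>_. count_space UNIV) \<Otimes>\<^sub>M borel) (\<lambda>\<omega>. (\<lambda>t\<in>{0..}. X t \<omega>, S \<omega>))"
    and S: "\<And>\<omega>. \<omega> \<in> space M \<Longrightarrow> 0 < S \<omega>"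
    and cont: "\<And>\<omega> t. \<omega> \<in> space M \<Longrightarrow> 0 \<le> t \<Longrightarrow> continuous (at_right t) (\<lambda>s. real (X s \<omega>))"
  shows measurable_at_independent_time:
      "(\<lambda>\<omega>. X (S \<omega>) \<omega>) \<in> measurable M (count_space UNIV)" (is ?meas)
    and expectation_at_independent_time: 
      "\<lbrakk>\<And>n. norm (f n) \<le> 1; \<And>t. 0 < t \<Longrightarrow> (LINT \<omega>|M. f (X t \<omega>)) = h t; continuous_on {0<..} h\<rbrakk>
        \<Longrightarrow> (LINT \<omega>|M. f (X (S \<omega>) \<omega>)) = (LINT \<omega>|M. h (S \<omega>))"
proof -
  let ?P = "PiM {0..} (\<lambda>_. count_space UNIV) :: (real \<Rightarrow> nat) measure"
  let ?X = "\<lambda>\<omega>. \<lambda>t\<in>{0..}. X t \<omega>"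
  \<comment> \<open>approximation of \<open>S\<close> from the right by times on a grid\<close>
  define T where "T n s = (real (nat \<lfloor>real (Suc n) * s\<rfloor>) + 1) / real (Suc n)" for n and s :: real
  have T_pos: "0 < T n s" for n s
    unfolding T_def by (intro divide_pos_pos) auto
  have T_bounds: "s < T n s" "T n s \<le> s + inverse (real (Suc n))" if "0 \<le> s" for n s
  proof -
    have "real (nat \<lfloor>real (Suc n) * s\<rfloor>) = of_int \<lfloor>real (Suc n) * s\<rfloor>"
      using that by simp
    then have "0 < real (Suc n)" "real (Suc n) * s < real (nat \<lfloor>real (Suc n) * s\<rfloor>) + 1"
      "real (nat \<lfloor>real (Suc n) * s\<rfloor>) \<le> real (Suc n) * s"
      by linarith+
    moreover have "s < (j + 1) / m" "(j + 1) / m \<le> s + inverse m"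
      if "0 < m" "m * s < j + 1" "j \<le> m * s" for j m :: real
      using that by (auto simp: field_simps)
    ultimately show "s < T n s" "T n s \<le> s + inverse (real (Suc n))"
      unfolding T_def by blast+
  qed
  have T_lim: "(\<lambda>n. T n s) \<longlonglongrightarrow> s" if "0 \<le> s" for s
  proof (rule real_tendsto_sandwich[of "\<lambda>_. s" _ _ "\<lambda>n. s + inverse (real (Suc n))"])
    show "(\<lambda>n. s + inverse (real (Suc n))) \<longlonglongrightarrow> s"
      using tendsto_add[OF tendsto_const LIMSEQ_inverse_real_of_nat, of s] by simp
    show "\<forall>\<^sub>F n in sequentially. s \<le> T n s" "\<forall>\<^sub>F n in sequentially. T n s \<le> s + inverse (real (Suc n))"
      using T_bounds[OF that] by (simp_all add: less_imp_le)
  qed simp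
  have X_lim: "\<forall>\<^sub>F n in sequentially. X (T n (S \<omega>)) \<omega> = X (S \<omega>) \<omega>" if \<omega>: "\<omega> \<in> space M" for \<omega>
  proof -
    have "0 \<le> S \<omega>" using S[OF \<omega>] by simp
    \<comment> \<open>Adding 1 after rounding down keeps \<open>T n s\<close> strictly above
      \<open>s\<close>, even when \<open>s\<close> is a grid point, as \<open>at_right\<close>
      requires.\<close>
    have "filterlim (\<lambda>n. T n (S \<omega>)) (at_right (S \<omega>)) sequentially"
      unfolding filterlim_at
    proof
      show "\<forall>\<^sub>F n in sequentially. T n (S \<omega>) \<in> {S \<omega><..} \<and> T n (S \<omega>) \<noteq> S \<omega>"
        using T_bounds(1)[OF \<open>0 \<le> S \<omega>\<close>]
        by (intro always_eventually allI) (metis greaterThan_iff less_irrefl)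
    qed (rule T_lim[OF \<open>0 \<le> S \<omega>\<close>])
    moreover have "((\<lambda>s. real (X s \<omega>)) \<longlongrightarrow> real (X (S \<omega>) \<omega>)) (at_right (S \<omega>))"
      using cont[OF \<omega> \<open>0 \<le> S \<omega>\<close>] by (simp add: continuous_within)
    ultimately have "(\<lambda>n. real (X (T n (S \<omega>)) \<omega>)) \<longlonglongrightarrow> real (X (S \<omega>) \<omega>)"
      by (rule filterlim_compose[rotated])
    then show ?thesis by (simp add: tendsto_of_nat_iff)
  qed
  have floor_meas [measurable]:
    "(\<lambda>s::real. nat \<lfloor>real (Suc n) * s\<rfloor>) \<in> measurable borel (count_space UNIV)" for n
    by measurable
  have grid_nonneg: "0 \<le> (real i + 1) / real (Suc n)" for i n
    by (intro divide_nonneg_nonneg) auto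
  have proj: "(\<lambda>x. x t) \<in> measurable ?P (count_space UNIV)" if "0 \<le> t" for t
    using that by (intro measurable_component_singleton) auto
  have X_meas: "X t \<in> measurable M (count_space UNIV)" if "0 \<le> t" for t
    using measurable_compose[OF rv(1) proj[OF that]] that by simp
  have XT_meas [measurable]: "(\<lambda>\<omega>. X (T n (S \<omega>)) \<omega>) \<in> measurable M (count_space UNIV)" for n
    unfolding T_def
  proof (rule measurable_compose_countable[where g = "\<lambda>\<omega>. nat \<lfloor>real (Suc n) * S \<omega>\<rfloor>"])
    show "X ((real i + 1) / real (Suc n)) \<in> measurable M (count_space UNIV)" for i
      by (rule X_meas[OF grid_nonneg])
  qed measurable
  \<comment> \<open>The limit is taken among real-valued functions; rounding down then recovers the
    natural number.\<close>
  have "(\<lambda>\<omega>. real (X (S \<omega>) \<omega>)) \<in> borel_measurable M"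
  proof (rule borel_measurable_LIMSEQ_metric)
    show "(\<lambda>\<omega>. real (X (T n (S \<omega>)) \<omega>)) \<in> borel_measurable M" for n
      by measurable
  qed (use X_lim in \<open>simp add: tendsto_of_nat_iff\<close>)
  then have "(\<lambda>\<omega>. nat \<lfloor>real (X (S \<omega>) \<omega>)\<rfloor>) \<in> measurable M (count_space UNIV)"
    by measurable
  then show meas [measurable]: ?meas by simp

  assume f: "\<And>n. norm (f n) \<le> 1"
    and h: "\<And>t. 0 < t \<Longrightarrow> (LINT \<omega>|M. f (X t \<omega>)) = h t" "continuous_on {0<..} h"
  have norm_h: "norm (h t) \<le> 1" if "0 < t" for t
  proof -
    have "integrable M (\<lambda>\<omega>. norm (f (X t \<omega>)))"
      using f X_meas[OF less_imp_le[OF that]] by (intro integrable_const_bound[where B = 1]) auto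
    then have "(LINT \<omega>|M. norm (f (X t \<omega>))) \<le> 1"
      using f by (intro integral_le_const) auto
    then show ?thesis
      using h(1)[OF that] integral_norm_bound[of M "\<lambda>\<omega>. f (X t \<omega>)"] by simp
  qed
  have hT_meas [measurable]: "(\<lambda>s. h (T n s)) \<in> borel_measurable borel" for n
    unfolding T_def
    by (rule measurable_compose_countable[where g = "\<lambda>s. nat \<lfloor>real (Suc n) * s\<rfloor>"])
      (rule borel_measurable_const floor_meas)+
  have hT_lim: "(\<lambda>n. h (T n (S \<omega>))) \<longlonglongrightarrow> h (S \<omega>)" if \<omega>: "\<omega> \<in> space M" for \<omega>
  proof (rule continuous_on_tendsto_compose[OF h(2)])
    show "(\<lambda>n. T n (S \<omega>)) \<longlonglongrightarrow> S \<omega>"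
      using S[OF \<omega>] by (intro T_lim) simp
  qed (use S[OF \<omega>] T_pos in auto)
  have "(LINT \<omega>|M. f (X (T n (S \<omega>)) \<omega>)) = (LINT \<omega>|M. h (T n (S \<omega>)))" for n
  proof -
    interpret P1: prob_space "distr M ?P ?X" by (rule prob_space_distr) measurable
    interpret P2: prob_space "distr M borel S" by (rule prob_space_distr) measurable
    interpret P: pair_prob_space "distr M ?P ?X" "distr M borel S" ..
    define \<Phi> where "\<Phi> x s = f (x (T n s))" for x and s :: real
    \<comment> \<open>Joint measurability in path and time holds because \<open>T n s\<close> takes
      only countably many values.\<close>
    have \<Phi> [measurable]: "(\<lambda>(x, s). \<Phi> x s) \<in> borel_measurable (?P \<Otimes>\<^sub>M borel)"
      unfolding \<Phi>_def T_def case_prod_beta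
    proof (rule measurable_compose_countable[where g = "\<lambda>z. nat \<lfloor>real (Suc n) * snd z\<rfloor>"])
      show "(\<lambda>z. f (fst z ((real i + 1) / real (Suc n)))) \<in> borel_measurable (?P \<Otimes>\<^sub>M borel)" for i
        by (rule measurable_compose[OF measurable_compose[OF measurable_fst proj[OF grid_nonneg]]]) simp
    qed measurable
    have "(LINT \<omega>|M. f (X (T n (S \<omega>)) \<omega>)) = (LINT \<omega>|M. \<Phi> (?X \<omega>) (S \<omega>))"
      using T_pos[THEN less_imp_le] by (simp add: \<Phi>_def)
    also have "\<dots> = integral\<^sup>L (distr M (?P \<Otimes>\<^sub>M borel) (\<lambda>\<omega>. (?X \<omega>, S \<omega>))) (\<lambda>(x, s). \<Phi> x s)"
      by (subst integral_distr) auto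
    also have "\<dots> = integral\<^sup>L (distr M ?P ?X \<Otimes>\<^sub>M distr M borel S) (\<lambda>(x, s). \<Phi> x s)"
      unfolding indep ..
    also have "\<dots> = (LINT s|distr M borel S. LINT x|distr M ?P ?X. \<Phi> x s)"
    proof (rule P.integral_snd[symmetric])
      show "integrable (distr M ?P ?X \<Otimes>\<^sub>M distr M borel S) (\<lambda>(x, s). \<Phi> x s)"
      proof (rule P.integrable_const_bound[where B = 1])
        show "AE z in distr M ?P ?X \<Otimes>\<^sub>M distr M borel S. norm ((\<lambda>(x, s). \<Phi> x s) z) \<le> 1"
          using f by (simp add: \<Phi>_def case_prod_beta)
      qed (use \<Phi> in simp)
    qed
    \<comment> \<open>With \<open>s\<close> fixed, \<open>T n s\<close> is a deterministic positive
      time, so the inner integral is given by \<open>h\<close>.\<close>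
    also have "\<dots> = (LINT s|distr M borel S. h (T n s))"
    proof (rule Bochner_Integration.integral_cong[OF refl])
      fix s
      have "(LINT x|distr M ?P ?X. \<Phi> x s) = (LINT \<omega>|M. f (X (T n s) \<omega>))"
        using integral_distr[OF rv(1) measurable_compose[OF proj[OF less_imp_le[OF T_pos]]], of f n s]
          less_imp_le[OF T_pos] by (simp add: \<Phi>_def)
      then show "(LINT x|distr M ?P ?X. \<Phi> x s) = h (T n s)"
        using h(1)[OF T_pos] by simp
    qed
    also have "\<dots> = (LINT \<omega>|M. h (T n (S \<omega>)))"
      by (subst integral_distr) auto
    finally show ?thesis .
  qed
  moreover have "(\<lambda>n. LINT \<omega>|M. f (X (T n (S \<omega>)) \<omega>)) \<longlonglongrightarrow> (LINT \<omega>|M. f (X (S \<omega>) \<omega>))"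
  proof (rule integral_dominated_convergence[where w = "\<lambda>_. 1"])
    show "AE \<omega> in M. (\<lambda>n. f (X (T n (S \<omega>)) \<omega>)) \<longlonglongrightarrow> f (X (S \<omega>) \<omega>)"
    proof (rule AE_I2)
      fix \<omega> assume "\<omega> \<in> space M"
      from X_lim[OF this] show "(\<lambda>n. f (X (T n (S \<omega>)) \<omega>)) \<longlonglongrightarrow> f (X (S \<omega>) \<omega>)"
        by (intro tendsto_eventually) (auto elim: eventually_mono)
    qed
  qed (use f in \<open>auto\<close>)
  moreover have "(\<lambda>n. LINT \<omega>|M. h (T n (S \<omega>))) \<longlonglongrightarrow> (LINT \<omega>|M. h (S \<omega>))"
  proof (rule integral_dominated_convergence[where w = "\<lambda>_. 1"])
    show "(\<lambda>\<omega>. h (S \<omega>)) \<in> borel_measurable M"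
      by (rule borel_measurable_LIMSEQ_metric[OF _ hT_lim]) auto
  qed (use hT_lim norm_h T_pos in auto)
  ultimately show "(LINT \<omega>|M. f (X (S \<omega>) \<omega>)) = (LINT \<omega>|M. h (S \<omega>))"
    using LIMSEQ_unique by simp
qed

end

text \<open>As a density against counting measure, the integral is the exponential series of
  \<open>a * u\<close> times \<open>exp (- a)\<close>.\<close>

lemma integral_poisson_pmf_power:
  fixes u :: complex
  assumes a: "0 < a" and u: "norm u \<le> 1"
  shows "(LINT n|measure_pmf (poisson_pmf a). u ^ n) = exp (- of_real a * (1 - u))"
proof -
  have "integrable (measure_pmf (poisson_pmf a)) (\<lambda>n. u ^ n)"
    using u by (intro measure_pmf.integrable_const_bound[where B = 1] AE_I2)
      (auto simp: norm_power power_le_one)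
  then have "integrable (count_space UNIV) (\<lambda>n. pmf (poisson_pmf a) n *\<^sub>R u ^ n)"
    unfolding measure_pmf_eq_density by (subst (asm) integrable_density) auto
  then have "(\<lambda>n. pmf (poisson_pmf a) n *\<^sub>R u ^ n) sums
      (LINT n|count_space UNIV. pmf (poisson_pmf a) n *\<^sub>R u ^ n)"
    by (rule sums_integral_count_space_nat)
  moreover have "(LINT n|measure_pmf (poisson_pmf a). u ^ n) =
      (LINT n|count_space UNIV. pmf (poisson_pmf a) n *\<^sub>R u ^ n)"
    unfolding measure_pmf_eq_density by (subst integral_density) auto
  ultimately have sums: "(\<lambda>n. pmf (poisson_pmf a) n *\<^sub>R u ^ n) sums
      (LINT n|measure_pmf (poisson_pmf a). u ^ n)"
    by simp
  have "(\<lambda>n. of_real (exp (- a)) * ((of_real a * u) ^ n /\<^sub>R fact n)) sums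
      (of_real (exp (- a)) * exp (of_real a * u))"
    by (intro sums_mult exp_converges)
  moreover have "of_real (exp (- a)) * ((of_real a * u) ^ n /\<^sub>R fact n) =
      pmf (poisson_pmf a) n *\<^sub>R u ^ n" for n
    using a by (simp add: power_mult_distrib scaleR_conv_of_real field_simps)
  ultimately have "(\<lambda>n. pmf (poisson_pmf a) n *\<^sub>R u ^ n) sums
      (of_real (exp (- a)) * exp (of_real a * u))"
    by simp
  then have "(LINT n|measure_pmf (poisson_pmf a). u ^ n) = of_real (exp (- a)) * exp (of_real a * u)"
    using sums sums_unique2 by blast
  then show ?thesis
    by (simp add: algebra_simps mult_exp_exp flip: exp_of_real)
qed

section \<open>The composed process\<close>

context prob_space begin

lemma laplace_transform_mittag_leffler:
  fixes W :: "'a \<Rightarrow> real"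
  assumes W: "W \<in> borel_measurable M" "\<And>\<omega>. \<omega> \<in> space M \<Longrightarrow> 0 < W \<omega>"
    and tail: "\<And>t. 0 \<le> t \<Longrightarrow> prob {\<omega>\<in>space M. t < W \<omega>} = mittag_leffler \<nu> 1 (- l * t powr \<nu>)"
    and "0 < \<nu>" "0 < l" and s: "0 < s" "l < s powr \<nu>"
  shows "(LINT \<omega>|M. exp (- s * W \<omega>)) = 1 / (1 + s powr \<nu> / l)"
proof -
  have eq: "(\<lambda>t. indicator {0<..} t * (prob {\<omega>\<in>space M. t < W \<omega>} * exp (- s * t))) =
      (\<lambda>t. indicator {0<..} t * (mittag_leffler \<nu> 1 (- l * t powr \<nu>) * exp (- s * t)))"
    using tail by (auto simp: indicator_def fun_eq_iff)
  have "(LINT \<omega>|M. exp (- s * W \<omega>)) = 1 - s * (1 / (s * (1 + l / s powr \<nu>)))"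
    by (rule laplace_transform_eq_tail_integral[OF W s(1)], assumption, subst eq)
      (rule has_bochner_integral_mittag_leffler[OF assms(4,5) s])
  moreover have "1 - s * (1 / (s * (1 + l / q))) = 1 / (1 + q / l)" if "0 < q" for q
  proof -
    have "1 - s * (1 / (s * (1 + l / q))) = 1 - 1 / (1 + l / q)"
      using s by simp
    also have "\<dots> = 1 / (1 + q / l)"
      using that \<open>0 < l\<close> by (simp add: field_simps)
    finally show ?thesis .
  qed
  ultimately show ?thesis
    using s by simp
qed

text \<open>Independence turns the transform of the sum into a product of equal factors, each known
  only for large real \<open>s\<close> at this stage.\<close>

lemma laplace_moment_renewal_epoch_real:
  fixes W :: "nat \<Rightarrow> 'a \<Rightarrow> real"
  assumes indep: "indep_vars (\<lambda>_. borel) W UNIV"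
    and pos: "\<And>i \<omega>. \<omega> \<in> space M \<Longrightarrow> 0 < W i \<omega>"
    and tail: "\<And>i t. 0 \<le> t \<Longrightarrow> prob {\<omega>\<in>space M. t < W i \<omega>} = mittag_leffler \<nu> 1 (- l * t powr \<nu>)"
    and "0 < \<nu>" "0 < l" "0 < s" "l < s powr \<nu>"
  shows "laplace_moment (\<lambda>\<omega>. \<Sum>i<k. W i \<omega>) 0 (of_real s) = of_real ((1 / (1 + s powr \<nu> / l)) ^ k)"
proof -
  have W [measurable]: "W i \<in> borel_measurable M" for i
    using indep by (auto simp: indep_vars_def)
  have exp_indep: "indep_vars (\<lambda>_. borel) (\<lambda>i \<omega>. exp (- s * W i \<omega>)) {..<k}"
    by (rule indep_vars_compose2[OF indep_vars_subset[OF indep]]) auto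
  have "laplace_moment (\<lambda>\<omega>. \<Sum>i<k. W i \<omega>) 0 (of_real s) =
      (LINT \<omega>|M. complex_of_real (\<Prod>i<k. exp (- s * W i \<omega>)))"
    unfolding laplace_moment_def
    by (simp add: sum_distrib_left sum_negf exp_of_real flip: exp_sum of_real_sum of_real_mult of_real_minus)
  also have "\<dots> = complex_of_real (LINT \<omega>|M. (\<Prod>i<k. exp (- s * W i \<omega>)))"
    by (rule integral_complex_of_real)
  also have "(LINT \<omega>|M. (\<Prod>i<k. exp (- s * W i \<omega>))) = (\<Prod>i<k. LINT \<omega>|M. exp (- s * W i \<omega>))"
  proof (rule indep_vars_lebesgue_integral[OF _ exp_indep])
    show "integrable M (\<lambda>\<omega>. exp (- s * W i \<omega>))" for i
      using pos \<open>0 < s\<close> by (intro integrable_const_bound[where B = 1] AE_I2) (auto simp: less_imp_le)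
  qed simp
  also have "(LINT \<omega>|M. exp (- s * W i \<omega>)) = 1 / (1 + s powr \<nu> / l)" for i
    using pos tail assms(4-) by (intro laplace_transform_mittag_leffler W) auto
  then have "(\<Prod>i<k. LINT \<omega>|M. exp (- s * W i \<omega>)) = (1 / (1 + s powr \<nu> / l)) ^ k"
    by simp
  finally show ?thesis .
qed

text \<open>The boundary \<open>Re s = 0\<close> is included because the generating function at
  \<open>u = 1\<close> needs the transform at 0.\<close>

lemma laplace_moment_renewal_epoch:
  fixes W :: "nat \<Rightarrow> 'a \<Rightarrow> real"
  assumes indep: "indep_vars (\<lambda>_. borel) W UNIV"
    and pos: "\<And>i \<omega>. \<omega> \<in> space M \<Longrightarrow> 0 < W i \<omega>"
    and tail: "\<And>i t. 0 \<le> t \<Longrightarrow> prob {\<omega>\<in>space M. t < W i \<omega>} = mittag_leffler \<nu> 1 (- l * t powr \<nu>)"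
    and \<nu>: "0 < \<nu>" "\<nu> \<le> 1" and l: "0 < l" and s: "0 \<le> Re s"
  shows "laplace_moment (\<lambda>\<omega>. \<Sum>i<k. W i \<omega>) 0 s = (1 / (1 + s powr of_real \<nu> / of_real l)) ^ k"
proof -
  let ?S = "\<lambda>\<omega>. \<Sum>i<k. W i \<omega>"
  let ?G = "\<lambda>s. (1 / (1 + s powr of_real \<nu> / of_real l)) ^ k :: complex"
  have [measurable]: "W i \<in> borel_measurable M" for i
    using indep by (auto simp: indep_vars_def)
  have S_meas: "?S \<in> borel_measurable M" by measurable
  have S_nonneg: "0 \<le> ?S \<omega>" if "\<omega> \<in> space M" for \<omega>
    using pos[OF that] by (intro sum_nonneg less_imp_le)
  have right: "laplace_moment ?S 0 z = ?G z" if z: "0 < Re z" for z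
  proof -
    \<comment> \<open>The threshold with \<open>b powr \<nu> = l\<close>: the real formula holds to
      the right of it.\<close>
    define b where "b = l powr (1 / \<nu>)"
    define U where "U = complex_of_real ` {b<..}"
    have b: "0 < b" using l by (simp add: b_def)
    have U: "laplace_moment ?S 0 w - ?G w = 0" if w: "w \<in> U" for w
    proof -
      obtain x where x: "b < x" "w = of_real x" using w by (auto simp: U_def)
      have "l = b powr \<nu>" using l \<nu> by (simp add: b_def powr_powr)
      also have "\<dots> < x powr \<nu>" using x b \<nu> by (intro powr_less_mono2) auto
      finally have "l < x powr \<nu>" .
      then show ?thesis
        using x b laplace_moment_renewal_epoch_real[OF indep pos tail \<nu>(1) l, of x k]
        by (simp add: powr_of_real)
    qed
    have "laplace_moment ?S 0 z - ?G z = 0"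
    proof (rule analytic_continuation[where f = "\<lambda>z. laplace_moment ?S 0 z - ?G z" and
          S = "{s. 0 < Re s}" and U = U and \<xi> = "of_real (b + 1)"])
      show "(\<lambda>z. laplace_moment ?S 0 z - ?G z) holomorphic_on {s. 0 < Re s}"
        using \<nu> l
        by (intro holomorphic_intros holomorphic_laplace_moment[OF S_meas S_nonneg])
          (auto simp: one_plus_powr_divide_neq_0 complex_nonpos_Reals_iff)
      show "open {s. 0 < Re s}" by (rule open_halfspace_Re_gt)
      show "connected {s. 0 < Re s}" by (intro convex_connected convex_halfspace_Re_gt)
      \<comment> \<open>Any point of the ray would serve; it is approached within the ray from the
        right.\<close>
      show "complex_of_real (b + 1) islimpt U"
        unfolding islimpt_sequential
      proof (intro exI conjI allI)
        show "complex_of_real (b + 1 + inverse (real (Suc n))) \<in> U - {of_real (b + 1)}" for n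
        proof -
          have "0 < inverse (real (Suc n))" by simp
          then have "b + 1 + inverse (real (Suc n)) \<in> {b<..}" "b + 1 + inverse (real (Suc n)) \<noteq> b + 1"
            unfolding greaterThan_iff by linarith+
          then show ?thesis
            unfolding U_def by (metis DiffI imageI of_real_eq_iff singletonD)
        qed
        have "(\<lambda>n. b + 1 + inverse (real (Suc n))) \<longlonglongrightarrow> b + 1"
          using tendsto_add[OF tendsto_const LIMSEQ_inverse_real_of_nat, of "b + 1"] by simp
        then show "(\<lambda>n. complex_of_real (b + 1 + inverse (real (Suc n)))) \<longlonglongrightarrow> of_real (b + 1)"
          by (rule tendsto_of_real)
      qed
    qed (use b z U in \<open>auto simp: U_def\<close>)
    then show ?thesis by simp
  qed
  \<comment> \<open>Shifting \<open>s\<close> slightly to the right approaches a boundary point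
    through the open half-plane.\<close>
  define X where "X n = s + of_real (inverse (real (Suc n)))" for n
  have X: "0 < Re (X n)" for n
    using s by (simp add: X_def add_nonneg_pos)
  have X_lim: "X \<longlonglongrightarrow> s"
    using tendsto_add[OF tendsto_const tendsto_of_real[OF LIMSEQ_inverse_real_of_nat], of s]
    by (simp add: X_def[abs_def])
  have "(\<lambda>n. laplace_moment ?S 0 (X n)) \<longlonglongrightarrow> laplace_moment ?S 0 s"
    by (rule tendsto_laplace_moment_0[OF S_meas S_nonneg less_imp_le[OF X] X_lim])
  moreover have "(\<lambda>n. laplace_moment ?S 0 (X n)) = (\<lambda>n. ?G (X n))"
    using right[OF X] by simp
  moreover have "(\<lambda>n. ?G (X n)) \<longlonglongrightarrow> ?G s"
    using s \<nu> l by (intro tendsto_intros X_lim one_plus_powr_divide_neq_0)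
      (auto simp: complex_nonpos_Reals_iff complex_eq_iff)
  ultimately show ?thesis
    using LIMSEQ_unique by metis
qed

lemma distr_poisson_process:
  assumes "poisson_process M l N" "0 < t"
  shows "distr M (count_space UNIV) (N t) = measure_pmf (poisson_pmf (l * t))"
proof -
  have "distr M (count_space UNIV) (\<lambda>\<omega>. N t \<omega> - N 0 \<omega>) = measure_pmf (poisson_pmf (l * (t - 0)))"
    using assms unfolding poisson_process_def by blast
  moreover have "distr M (count_space UNIV) (N t) = distr M (count_space UNIV) (\<lambda>\<omega>. N t \<omega> - N 0 \<omega>)"
    using assms(1) by (intro distr_cong) (auto simp: poisson_process_def)
  ultimately show ?thesis by simp
qed

lemma integral_poisson_process:
  fixes f :: "nat \<Rightarrow> complex"
  assumes "poisson_process M l N" "0 < t"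
  shows "(LINT \<omega>|M. f (N t \<omega>)) = (LINT n|measure_pmf (poisson_pmf (l * t)). f n)"
proof -
  have "N t \<in> measurable M (count_space UNIV)"
    using assms by (auto simp: poisson_process_def)
  then show ?thesis
    unfolding distr_poisson_process[OF assms, symmetric] by (subst integral_distr) auto
qed

end

theorem theorem3p1:
  fixes M :: "'a measure"
    and \<nu> l\<^sub>\<alpha> l\<^sub>\<beta> :: real
    and N N\<^sub>\<alpha> :: "real \<Rightarrow> 'a \<Rightarrow> nat"
  assumes "prob_space M"
    and "0 < \<nu>" "\<nu> \<le> 1" "0 < l\<^sub>\<alpha>" "0 < l\<^sub>\<beta>"
    and "fractional_poisson_process M \<nu> l\<^sub>\<beta> N"
    and "poisson_process M l\<^sub>\<alpha> N\<^sub>\<alpha>"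
    and "indep_processes M N\<^sub>\<alpha> N"
  shows "\<forall>k\<ge>1.
      (\<forall>r.
        (l\<^sub>\<beta> < l\<^sub>\<alpha> powr \<nu> \<longrightarrow>
           summable (\<lambda>j. ((- real k) gchoose j) * (l\<^sub>\<beta> / l\<^sub>\<alpha> powr \<nu>) ^ (k + j) *
             (Gamma (\<nu> * real (k + j) + real r) / Gamma (\<nu> * real (k + j)))) \<and>
           measure M {\<omega>\<in>space M. composed_process N\<^sub>\<alpha> N k \<omega> = r} =
             1 / fact r * (\<Sum>j. ((- real k) gchoose j) * (l\<^sub>\<beta> / l\<^sub>\<alpha> powr \<nu>) ^ (k + j) *
               (Gamma (\<nu> * real (k + j) + real r) / Gamma (\<nu> * real (k + j))))) \<and>
        (\<exists>v. continued_state_sum \<nu> k r (l\<^sub>\<beta> / l\<^sub>\<alpha> powr \<nu>) v \<and>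
           measure M {\<omega>\<in>space M. composed_process N\<^sub>\<alpha> N k \<omega> = r} = 1 / fact r * v)) \<and>
      (\<forall>u :: complex. norm u \<le> 1 \<longrightarrow>
        (LINT \<omega>|M. u ^ composed_process N\<^sub>\<alpha> N k \<omega>) =
          (1 + (1 - u) powr of_real \<nu> * of_real (l\<^sub>\<alpha> powr \<nu> / l\<^sub>\<beta>)) powi (- int k))"
proof (intro allI impI)
  fix k :: nat assume k: "1 \<le> k"
  interpret prob_space M by fact
  note \<nu> = \<open>0 < \<nu>\<close> \<open>\<nu> \<le> 1\<close>
  obtain W :: "nat \<Rightarrow> 'a \<Rightarrow> real" where
      W_indep: "indep_vars (\<lambda>_. borel) W UNIV"
    and W_pos: "\<And>i \<omega>. \<omega> \<in> space M \<Longrightarrow> 0 < W i \<omega>"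
    and W_tail: "\<And>i t. 0 \<le> t \<Longrightarrow>
      prob {\<omega>\<in>space M. t < W i \<omega>} = mittag_leffler \<nu> 1 (- l\<^sub>\<beta> * t powr \<nu>)"
    and N_eq: "\<And>t \<omega>. 0 \<le> t \<Longrightarrow> \<omega> \<in> space M \<Longrightarrow> N t \<omega> = renewal_count W t \<omega>"
    using \<open>fractional_poisson_process M \<nu> l\<^sub>\<beta> N\<close> unfolding fractional_poisson_process_def by blast
  define S where "S n \<omega> = (\<Sum>i<n. W i \<omega>)" for n \<omega>
  define c where "c = l\<^sub>\<beta> / l\<^sub>\<alpha> powr \<nu>"
  have S_mono: "strict_mono (\<lambda>n. S n \<omega>)" if "\<omega> \<in> space M" for \<omega>
    using W_pos[OF that] by (simp add: strict_mono_Suc_iff S_def)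
  have S_pos: "0 < S k \<omega>" "S k \<omega> < S (Suc k) \<omega>" if "\<omega> \<in> space M" for \<omega>
    using strict_monoD[OF S_mono[OF that], of 0 k] strict_monoD[OF S_mono[OF that], of k "Suc k"] k
    by (simp_all add: S_def)
  have N_iff: "N t \<omega> = k \<longleftrightarrow> S k \<omega> \<le> t \<and> t < S (Suc k) \<omega>" if "\<omega> \<in> space M" "0 \<le> t" for \<omega> t
    using card_epochs_eq_iff[OF S_mono[OF that(1)] k, of t] N_eq[OF that(2,1)]
    by (simp add: renewal_count_def S_def)
  have composed: "composed_process N\<^sub>\<alpha> N k \<omega> = N\<^sub>\<alpha> (S k \<omega>) \<omega>" if "\<omega> \<in> space M" for \<omega>
    using Inf_hitting_set_eq[of "S k \<omega>" "S (Suc k) \<omega>" "\<lambda>t. N t \<omega>"] S_pos[OF that] N_iff[OF that]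
    by (simp add: composed_process_def hitting_time_def)
  have indep: "indep_var (PiM {0..} (\<lambda>_. count_space UNIV)) (\<lambda>\<omega>. \<lambda>t\<in>{0..}. N\<^sub>\<alpha> t \<omega>)
      (PiM {0..} (\<lambda>_. count_space UNIV)) (\<lambda>\<omega>. \<lambda>t\<in>{0..}. N t \<omega>)"
    using \<open>indep_processes M N\<^sub>\<alpha> N\<close> by (simp add: indep_processes_def)
  have S_bounds: "0 \<le> S k \<omega> \<and> S k \<omega> < S (Suc k) \<omega>" if "\<omega> \<in> space M" for \<omega>
    using S_pos[OF that] by simp
  have S_meas [measurable]: "S k \<in> borel_measurable M"
    by (rule measurable_interval_start[OF indep S_bounds N_iff])
  have cont: "continuous (at_right t) (\<lambda>s. real (N\<^sub>\<alpha> s \<omega>))" if "\<omega> \<in> space M" "0 \<le> t" for \<omega> t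
    using \<open>poisson_process M l\<^sub>\<alpha> N\<^sub>\<alpha>\<close> that by (simp add: poisson_process_def)
  \<comment> \<open>Independence is assumed for \<open>N\<close>, not for the inter-arrival times,
    so the epoch \<open>S k\<close> is treated as a functional of the path of
    \<open>N\<close>.\<close>
  note at_time = indep_var_rv1[OF indep] S_meas
    distr_pair_interval_start[OF indep S_bounds N_iff] S_pos(1) cont
  have [measurable]: "(\<lambda>\<omega>. N\<^sub>\<alpha> (S k \<omega>) \<omega>) \<in> measurable M (count_space UNIV)"
    by (rule measurable_at_independent_time[OF at_time])
  have L: "laplace_moment (S k) 0 s = (1 / (1 + s powr of_real \<nu> / of_real l\<^sub>\<beta>)) ^ k" if "0 \<le> Re s" for s
    unfolding S_def[abs_def]
    by (rule laplace_moment_renewal_epoch[OF W_indep W_pos W_tail \<nu> \<open>0 < l\<^sub>\<beta>\<close> that])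

  have state: "complex_of_real (prob {\<omega>\<in>space M. composed_process N\<^sub>\<alpha> N k \<omega> = r}) =
      1 / fact r * state_function \<nu> k r (of_real c)" for r
  proof -
    \<comment> \<open>\<open>f\<close> encodes the event that the value is \<open>r\<close>, and
      \<open>h t\<close> is the Poisson probability of \<open>r\<close> at time
      \<open>t\<close>.\<close>
    define f where "f n = complex_of_real (indicator {r} n)" for n
    define h where "h t = complex_of_real ((l\<^sub>\<alpha> * t) ^ r / fact r * exp (- (l\<^sub>\<alpha> * t)))" for t
    have "complex_of_real (prob {\<omega>\<in>space M. composed_process N\<^sub>\<alpha> N k \<omega> = r}) =
        complex_of_real (LINT \<omega>|M. indicator {\<omega>\<in>space M. N\<^sub>\<alpha> (S k \<omega>) \<omega> = r} \<omega>)"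
      using composed by (simp cong: conj_cong)
    also have "\<dots> = (LINT \<omega>|M. f (N\<^sub>\<alpha> (S k \<omega>) \<omega>))"
      unfolding integral_complex_of_real[symmetric] f_def
      by (intro Bochner_Integration.integral_cong) (auto simp: indicator_def)
    also have "\<dots> = (LINT \<omega>|M. h (S k \<omega>))"
    proof (rule expectation_at_independent_time[OF at_time])
      show "(LINT \<omega>|M. f (N\<^sub>\<alpha> t \<omega>)) = h t" if "0 < t" for t
      proof -
        have "(LINT \<omega>|M. f (N\<^sub>\<alpha> t \<omega>)) =
            complex_of_real (LINT n|measure_pmf (poisson_pmf (l\<^sub>\<alpha> * t)). indicator {r} n)"
          by (subst integral_poisson_process[OF \<open>poisson_process M l\<^sub>\<alpha> N\<^sub>\<alpha>\<close> that])
            (simp only: f_def[abs_def] integral_complex_of_real)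
        then show ?thesis
          using that \<open>0 < l\<^sub>\<alpha>\<close> by (simp add: h_def measure_pmf_single)
      qed
      show "continuous_on {0<..} h"
        unfolding h_def[abs_def] by (intro continuous_intros) auto
    qed (auto simp: f_def indicator_def)
    also have "\<dots> = (LINT \<omega>|M. of_real l\<^sub>\<alpha> ^ r / fact r *
        (of_real (S k \<omega>) ^ r * exp (- of_real l\<^sub>\<alpha> * of_real (S k \<omega>))))"
      by (intro Bochner_Integration.integral_cong)
        (simp_all add: h_def power_mult_distrib flip: exp_of_real)
    also have "\<dots> = 1 / fact r * (of_real l\<^sub>\<alpha> ^ r * laplace_moment (S k) r (of_real l\<^sub>\<alpha>))"
      by (simp add: laplace_moment_def)
    also have "of_real l\<^sub>\<alpha> ^ r * laplace_moment (S k) r (of_real l\<^sub>\<alpha>) =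
        state_function \<nu> k r (of_real l\<^sub>\<beta> * of_real l\<^sub>\<alpha> powr - of_real \<nu>)"
      using S_bounds \<open>0 < l\<^sub>\<alpha>\<close> L
      by (intro laplace_moment_eq_state_function[OF S_meas _ \<nu> \<open>0 < l\<^sub>\<beta>\<close>]) auto
    also have "of_real l\<^sub>\<beta> * of_real l\<^sub>\<alpha> powr - of_real \<nu> = complex_of_real c"
      using \<open>0 < l\<^sub>\<alpha>\<close> by (simp add: c_def powr_minus powr_of_real divide_inverse)
    finally show ?thesis .
  qed

  have pgf: "(LINT \<omega>|M. u ^ composed_process N\<^sub>\<alpha> N k \<omega>) =
      (1 + (1 - u) powr of_real \<nu> * of_real (l\<^sub>\<alpha> powr \<nu> / l\<^sub>\<beta>)) powi (- int k)"
    if u: "norm u \<le> 1" for u :: complex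
  proof -
    have Re_u: "0 \<le> Re (1 - u)"
      using complex_Re_le_cmod[of u] u by simp
    have "(LINT \<omega>|M. u ^ composed_process N\<^sub>\<alpha> N k \<omega>) = (LINT \<omega>|M. u ^ N\<^sub>\<alpha> (S k \<omega>) \<omega>)"
      by (intro Bochner_Integration.integral_cong) (simp_all add: composed)
    also have "\<dots> = (LINT \<omega>|M. exp (- of_real (l\<^sub>\<alpha> * S k \<omega>) * (1 - u)))"
    proof (rule expectation_at_independent_time[OF at_time])
      show "norm (u ^ n) \<le> 1" for n
        using u by (simp add: norm_power power_le_one)
      show "(LINT \<omega>|M. u ^ N\<^sub>\<alpha> t \<omega>) = exp (- of_real (l\<^sub>\<alpha> * t) * (1 - u))" if "0 < t" for t
        using that \<open>0 < l\<^sub>\<alpha>\<close> u integral_poisson_pmf_power[of "l\<^sub>\<alpha> * t" u]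
          integral_poisson_process[OF \<open>poisson_process M l\<^sub>\<alpha> N\<^sub>\<alpha>\<close> that, of "\<lambda>n. u ^ n"] by simp
      show "continuous_on {0<..} (\<lambda>t. exp (- of_real (l\<^sub>\<alpha> * t) * (1 - u)))"
        by (intro continuous_intros)
    qed
    also have "\<dots> = laplace_moment (S k) 0 (of_real l\<^sub>\<alpha> * (1 - u))"
      by (simp add: laplace_moment_def mult_ac)
    also have "\<dots> = (1 / (1 + (of_real l\<^sub>\<alpha> * (1 - u)) powr of_real \<nu> / of_real l\<^sub>\<beta>)) ^ k"
      using Re_u \<open>0 < l\<^sub>\<alpha>\<close> by (intro L) simp
    \<comment> \<open>A positive real factor does not change the argument, so it splits off the
      principal power.\<close>
    also have "(of_real l\<^sub>\<alpha> * (1 - u)) powr of_real \<nu> = of_real (l\<^sub>\<alpha> powr \<nu>) * (1 - u) powr of_real \<nu>"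
      using \<open>0 < l\<^sub>\<alpha>\<close> by (simp add: powr_times_real_left powr_of_real)
    finally show ?thesis
      by (simp add: power_int_minus power_one_over inverse_eq_divide mult_ac)
  qed

  have "(l\<^sub>\<beta> < l\<^sub>\<alpha> powr \<nu> \<longrightarrow>
         summable (\<lambda>j. ((- real k) gchoose j) * c ^ (k + j) *
           (Gamma (\<nu> * real (k + j) + real r) / Gamma (\<nu> * real (k + j)))) \<and>
         prob {\<omega>\<in>space M. composed_process N\<^sub>\<alpha> N k \<omega> = r} =
           1 / fact r * (\<Sum>j. ((- real k) gchoose j) * c ^ (k + j) *
             (Gamma (\<nu> * real (k + j) + real r) / Gamma (\<nu> * real (k + j))))) \<and>
      (\<exists>v. continued_state_sum \<nu> k r c v \<and>
         prob {\<omega>\<in>space M. composed_process N\<^sub>\<alpha> N k \<omega> = r} = 1 / fact r * v)" for r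
  proof -
    \<comment> \<open>Defining \<open>v\<close> from the probability makes it real, so the state
      function takes a real value at \<open>c\<close>.\<close>
    define v where "v = fact r * prob {\<omega>\<in>space M. composed_process N\<^sub>\<alpha> N k \<omega> = r}"
    have v: "state_function \<nu> k r (of_real c) = of_real v"
      using state[of r] by (simp add: v_def)
    have prob: "prob {\<omega>\<in>space M. composed_process N\<^sub>\<alpha> N k \<omega> = r} = 1 / fact r * v"
      by (simp add: v_def)
    have cont_sum: "continued_state_sum \<nu> k r c v"
      unfolding continued_state_sum_def
      using holomorphic_state_function state_series_term_sums \<nu> k v by blast
    have sums: "(\<lambda>j. ((- real k) gchoose j) * c ^ (k + j) *
        (Gamma (\<nu> * real (k + j) + real r) / Gamma (\<nu> * real (k + j)))) sums v"
      if "l\<^sub>\<beta> < l\<^sub>\<alpha> powr \<nu>"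
    proof -
      \<comment> \<open>The assumption on the rates places \<open>c\<close> inside the disc of
        convergence, where the continuation is the ordinary sum.\<close>
      have "norm (complex_of_real c) < 1"
        using that \<open>0 < l\<^sub>\<alpha>\<close> \<open>0 < l\<^sub>\<beta>\<close> unfolding norm_of_real by (simp add: c_def)
      then have "state_series_term \<nu> k r (complex_of_real c) sums of_real v"
        using state_series_term_sums[of "of_real c" \<nu> k r] \<nu> k v by simp
      moreover have "state_series_term \<nu> k r (complex_of_real c) =
          (\<lambda>j. complex_of_real (state_series_term \<nu> k r c j))"
        by (simp add: state_series_term_def fun_eq_iff)
      ultimately have "state_series_term \<nu> k r c sums v"
        by (simp add: sums_of_real_iff)
      then show ?thesis
        by (simp only: state_series_term_def[abs_def] of_real_eq_id id_apply)
    qed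
    show ?thesis
      using cont_sum prob sums unfolding sums_iff by blast
  qed
  with pgf show "(\<forall>r.
        (l\<^sub>\<beta> < l\<^sub>\<alpha> powr \<nu> \<longrightarrow>
           summable (\<lambda>j. ((- real k) gchoose j) * (l\<^sub>\<beta> / l\<^sub>\<alpha> powr \<nu>) ^ (k + j) *
             (Gamma (\<nu> * real (k + j) + real r) / Gamma (\<nu> * real (k + j)))) \<and>
           measure M {\<omega>\<in>space M. composed_process N\<^sub>\<alpha> N k \<omega> = r} =
             1 / fact r * (\<Sum>j. ((- real k) gchoose j) * (l\<^sub>\<beta> / l\<^sub>\<alpha> powr \<nu>) ^ (k + j) *
               (Gamma (\<nu> * real (k + j) + real r) / Gamma (\<nu> * real (k + j))))) \<and>
        (\<exists>v. continued_state_sum \<nu> k r (l\<^sub>\<beta> / l\<^sub>\<alpha> powr \<nu>) v \<and>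
           measure M {\<omega>\<in>space M. composed_process N\<^sub>\<alpha> N k \<omega> = r} = 1 / fact r * v)) \<and>
      (\<forall>u :: complex. norm u \<le> 1 \<longrightarrow>
        (LINT \<omega>|M. u ^ composed_process N\<^sub>\<alpha> N k \<omega>) =
          (1 + (1 - u) powr of_real \<nu> * of_real (l\<^sub>\<alpha> powr \<nu> / l\<^sub>\<beta>)) powi (- int k))"
    unfolding c_def by blast
qed

end
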